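(* For every $\epsilon>0$ there exists a constant $C_\epsilon<\infty$ such that for all $r,j,t\in\mathbb N$ with $r\le j$, all $w\in\mathbb S^1$, $m\in\mathbb R^2$, every collection $\mathcal T=\{\mathcal T_n\}_{n=1}^3$ of finite families of unit-width tubes in $\mathbb R^3$ of $(r,j,t,w,m)$-type, and all $R>0$, $$\int_{Q_R}\prod_{n=1}^3\Big(\sum_{T_n\in\mathcal T_n}\chi_{T_n}\Big)^{\frac12}\le C_\epsilon R^{\epsilon}\,2^{\frac12(j+t+r)}\prod_{n=1}^3|\mathcal T_n|^{\frac12}.$$
   Context: $A\sim B$ means that $A$ and $B$ are comparable up to fixed absolute multiplicative constants. $Q_R$ is the ball of radius $R$ in $\mathbb R^3$. A unit-width tube is the $1$-neighbourhood of a line in $\mathbb R^3$; $d(T)\in\mathbb S^2$ is its direction. $\tau^i_k\subset\mathbb R^2$ is the square of side length $2^{-i}$ with lower-left vertex $k$, and $\mathfrak t^{i}_{w,m}=\{\xi\in[0,2]^2:\ |\xi-m-w((\xi-m)\cdot w)|\le2^{-i}\}$ is the strip of width $2^{-i}$ in direction $w\in\mathbb S^1$ through $m$. Let $S_1,S_2,S_3\subset\{(\xi,\frac12|\xi|^2):|\xi|\le2\}$ satisfy $|n(\xi_1)\wedge n(\xi_2)\wedge n(\xi_3)|\sim\theta$ for all $\xi_n\in S_n$, where $n(\xi_n)$ is the (unit) normal vector to $S_n$ at $\xi_n$. Suppose that for every $T_n\in\mathcal T_n$ we have $d(T_n)=n(\xi_n)$ for some $\xi_n\in S_n$. The collection $\{\mathcal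 T_n\}_{n=1}^3$ is of $(r,j,t,w,m)$-type, where $r\le j$, if, possibly after reordering the sets $S_n$, $S_1\subset\{(\xi,\frac12|\xi|^2):\xi\in\tau^j_k\cap\mathfrak t^{j+t}_{w,m}\}$, $S_2\subset\{(\xi,\frac12|\xi|^2):\xi\in\tau^j_{k'}\cap\mathfrak t^{j+t}_{w,m}\}$, $S_3\subset\{(\xi,\frac12|\xi|^2):\xi\in\tau^r_{k''}\cap\mathfrak t^{r+t}_{w',m}\}$ for some $k,k',k'',w'$ such that $m\in\tau^j_k$, $d(\tau^j_k,\tau^j_{k'})\sim2^{-j}$, $d(\tau^j_{k'},\tau^r_{k''})\sim d(\tau^j_k,\tau^r_{k''})\sim2^{-r}$, $|w-w'|\sim2^{-t}$, and $\theta\sim2^{-j}2^{-r}2^{-t}$.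
   Formalization: The bound is stated for all R>0 when ε≤3 but only for R≥1 when ε>3, since for ε>3 it fails as R→0 (three transversal tubes through the origin give a left side of order R³). *)

theory Defs
  imports "HOL-Analysis.Analysis"
begin

definition comparable :: "real \<Rightarrow> real \<Rightarrow> real \<Rightarrow> bool" where
  "comparable K A B \<longleftrightarrow> B / K \<le> A \<and> A \<le> K * B"

definition dyadic_square :: "nat \<Rightarrow> real^2 \<Rightarrow> (real^2) set" where
  "dyadic_square i k = cbox k (\<chi> c. k $ c + (1/2)^i)"

definition strip :: "nat \<Rightarrow> real^2 \<Rightarrow> real^2 \<Rightarrow> (real^2) set" where
  "strip i w m = {\<xi> \<in> cbox 0 (\<chi> c. 2).
     norm (\<xi> - m - ((\<xi> - m) \<bullet> w) *\<^sub>R w) \<le> (1/2)^i}"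

definition parab :: "real^2 \<Rightarrow> real^3" where
  "parab \<xi> = vector [\<xi> $ 1, \<xi> $ 2, (norm \<xi>)\<^sup>2 / 2]"

text \<open>The tangent plane of the paraboloid at \<open>p = parab \<xi>\<close> is spanned by \<open>(1, 0, p $ 1)\<close> and
  \<open>(0, 1, p $ 2)\<close>; \<open>sgn\<close> normalises to length one. The choice of orientation is immaterial:
  the normal enters only through the absolute value of a determinant and as the direction of a
  line.\<close>

definition unit_normal :: "real^3 \<Rightarrow> real^3" where
  "unit_normal p = sgn (vector [- (p $ 1), - (p $ 2), 1])"

lemma unit_normal_orthogonal:
  "unit_normal p \<bullet> vector [1, 0, p $ 1] = 0"
  "unit_normal p \<bullet> vector [0, 1, p $ 2] = 0"
  by (simp_all add: unit_normal_def sgn_div_norm inner_vec_def sum_3 algebra_simps)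

definition unit_tube :: "real^3 \<Rightarrow> real^3 \<Rightarrow> (real^3) set" where
  "unit_tube a v = {x. infdist x (range (\<lambda>s. a + s *\<^sub>R v)) \<le> 1}"

text \<open>Here \<open>K\<close> is the implicit constant in every comparability relation, and the families are
  indexed by the three-element type \<open>3\<close> (in which \<open>3 = 0\<close>). The determinant of the matrix with
  rows \<open>unit_normal (\<xi> n)\<close> is the wedge product of the three normals.\<close>

definition of_type ::
  "real \<Rightarrow> nat \<Rightarrow> nat \<Rightarrow> nat \<Rightarrow> real^2 \<Rightarrow> real^2 \<Rightarrow> (3 \<Rightarrow> (real^3) set set) \<Rightarrow> bool" where
  "of_type K r j t w m \<T> \<longleftrightarrow>
    (\<exists>S \<theta>. \<theta> > 0 \<and>
      (\<forall>n. S n \<subseteq> parab ` cball 0 2) \<and>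
      (\<forall>\<xi>. (\<forall>n. \<xi> n \<in> S n) \<longrightarrow> comparable K \<bar>det (\<chi> n. unit_normal (\<xi> n))\<bar> \<theta>) \<and>
      (\<forall>n. \<forall>T\<in>\<T> n. \<exists>\<xi>\<in>S n. \<exists>a. T = unit_tube a (unit_normal \<xi>)) \<and>
      (\<exists>(p :: 3 \<Rightarrow> 3) k k' k'' w'. bij p \<and> w' \<in> sphere 0 1 \<and>
        S (p 1) \<subseteq> parab ` (dyadic_square j k \<inter> strip (j + t) w m) \<and>
        S (p 2) \<subseteq> parab ` (dyadic_square j k' \<inter> strip (j + t) w m) \<and>
        S (p 3) \<subseteq> parab ` (dyadic_square r k'' \<inter> strip (r + t) w' m) \<and>
        m \<in> dyadic_square j k \<and>
        comparable K (setdist (dyadic_square j k) (dyadic_square j k')) ((1/2)^j) \<and>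
        comparable K (setdist (dyadic_square j k') (dyadic_square r k'')) ((1/2)^r) \<and>
        comparable K (setdist (dyadic_square j k) (dyadic_square r k'')) ((1/2)^r) \<and>
        comparable K (norm (w - w')) ((1/2)^t) \<and>
        comparable K \<theta> ((1/2)^j * (1/2)^r * (1/2)^t)))"

end

theory Submission imports Defs begin

text \<open>
  Directions of tubes are normals \<open>(-\<xi>, 1)\<close>. Put \<open>\<kappa> = 2 ^ (- j)\<close>, \<open>\<rho> = 2 ^ (- r)\<close>, \<open>\<tau> = 2 ^ (- t)\<close>. In the frame
  \<open>(w, perp w)\<close> centred at \<open>m\<close>, the parameters of the first two families lie in a box \<open>\<kappa> \<times> \<kappa>\<tau>\<close>, those of
  the third in a box \<open>\<rho> \<times> \<rho>\<tau>\<close>, and the triangle \<open>\<xi>\<^sub>1\<xi>\<^sub>2\<xi>\<^sub>3\<close> has area comparable to \<open>\<kappa>\<rho>\<tau>\<close>. Cut every box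
  into boundedly many similar boxes and fix a triple of pieces with base normals \<open>g\<^sub>1, g\<^sub>2, g\<^sub>3\<close>. If
  \<open>c\<^sub>k\<close> are the coordinates with respect to this basis, then the linear map with components
  \<open>\<tau>\<kappa>c\<^sub>1\<close>, \<open>\<tau>\<kappa>c\<^sub>2\<close>, \<open>\<tau>\<rho>c\<^sub>3\<close> has bounded norm and takes the tubes of the \<open>k\<close>-th family into bounded
  neighbourhoods of lines that are almost parallel to the \<open>k\<close>-th axis.

  On the preimage \<open>Q\<close> of a lattice unit cube, Cauchy-Schwarz gives
  \<open>\<integral>\<^sub>Q (f\<^sub>1 f\<^sub>2 f\<^sub>3)\<^sup>1\<^sup>/\<^sup>2 \<le> (\<integral> f\<^sub>1 f\<^sub>2)\<^sup>1\<^sup>/\<^sup>2 (\<integral>\<^sub>Q f\<^sub>3)\<^sup>1\<^sup>/\<^sup>2\<close>. Two tubes of the first two families meet in volume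
  \<open>O(1/\<kappa>)\<close>, and a tube of the third family meets \<open>Q\<close> in volume \<open>O(1/(\<rho>\<tau>))\<close>, so the whole factor
  \<open>(\<kappa>\<rho>\<tau>)\<^sup>-\<^sup>1\<^sup>/\<^sup>2\<close> is lost here, once. What remains is to sum the product of the square roots of the numbers of
  lines near a lattice point. This is Guth's induction on scales for the multilinear Kakeya
  inequality: passing from scale \<open>M\<close> to scale \<open>1\<close> costs, by the discrete Loomis-Whitney inequality,
  a constant independent of \<open>M\<close>, and taking \<open>M\<close> large turns the accumulated constant into \<open>R\<^sup>\<epsilon>\<close>.
\<close>

section \<open>Discrete multilinear Kakeya inequality\<close>

lemma sum_sqrt_mult_le:
  fixes f g :: "'a \<Rightarrow> real"
  assumes "\<And>x. x \<in> A \<Longrightarrow> 0 \<le> f x" "\<And>x. x \<in> A \<Longrightarrow> 0 \<le> g x"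
  shows "(\<Sum>x\<in>A. sqrt (f x) * sqrt (g x)) \<le> sqrt (sum f A) * sqrt (sum g A)"
proof -
  have "(\<Sum>x\<in>A. sqrt (f x) * sqrt (g x)) \<le> L2_set (\<lambda>x. sqrt (f x)) A * L2_set (\<lambda>x. sqrt (g x)) A"
    using L2_set_mult_ineq[of "\<lambda>x. sqrt (f x)" "\<lambda>x. sqrt (g x)" A] assms by simp
  also have "\<dots> = sqrt (sum f A) * sqrt (sum g A)"
    unfolding L2_set_def using assms by simp
  finally show ?thesis .
qed

text \<open>Cauchy-Schwarz is applied twice: first in \<open>z\<close> for fixed \<open>x\<close>
  and \<open>y\<close>, which leaves a function of \<open>y\<close> times a function of
  \<open>x\<close>, then over the pairs \<open>(x, y)\<close>, where the sum of this product
  factorises.\<close>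

lemma discrete_loomis_whitney:
  fixes f g h :: "'a \<Rightarrow> 'a \<Rightarrow> real"
  assumes nonneg: "\<And>x y. 0 \<le> f x y" "\<And>x y. 0 \<le> g x y" "\<And>x y. 0 \<le> h x y"
  shows "(\<Sum>x\<in>X. \<Sum>y\<in>Y. \<Sum>z\<in>Z. sqrt (f y z) * sqrt (g x z) * sqrt (h x y))
    \<le> sqrt (\<Sum>y\<in>Y. \<Sum>z\<in>Z. f y z) * sqrt (\<Sum>x\<in>X. \<Sum>z\<in>Z. g x z) * sqrt (\<Sum>x\<in>X. \<Sum>y\<in>Y. h x y)"
proof -
  define F where "F y = (\<Sum>z\<in>Z. f y z)" for y
  define G where "G x = (\<Sum>z\<in>Z. g x z)" for x
  have FG: "0 \<le> F y" "0 \<le> G x" for x y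
    unfolding F_def G_def by (auto intro: sum_nonneg nonneg)
  have "(\<Sum>x\<in>X. \<Sum>y\<in>Y. \<Sum>z\<in>Z. sqrt (f y z) * sqrt (g x z) * sqrt (h x y))
      = (\<Sum>x\<in>X. \<Sum>y\<in>Y. (\<Sum>z\<in>Z. sqrt (f y z) * sqrt (g x z)) * sqrt (h x y))"
    by (simp add: sum_distrib_right)
  also have "\<dots> \<le> (\<Sum>x\<in>X. \<Sum>y\<in>Y. (sqrt (F y) * sqrt (G x)) * sqrt (h x y))"
    unfolding F_def G_def by (intro sum_mono mult_right_mono sum_sqrt_mult_le) (auto simp: nonneg)
  also have "\<dots> = (\<Sum>q\<in>X \<times> Y. sqrt (F (snd q) * G (fst q)) * sqrt (h (fst q) (snd q)))"
    by (simp add: sum.cartesian_product case_prod_beta real_sqrt_mult)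
  also have "\<dots> \<le> sqrt (\<Sum>q\<in>X \<times> Y. F (snd q) * G (fst q)) * sqrt (\<Sum>q\<in>X \<times> Y. h (fst q) (snd q))"
    by (intro sum_sqrt_mult_le) (auto simp: nonneg FG)
  also have "(\<Sum>q\<in>X \<times> Y. F (snd q) * G (fst q)) = sum F Y * sum G X"
  proof -
    have "(\<Sum>q\<in>X \<times> Y. F (snd q) * G (fst q)) = (\<Sum>x\<in>X. \<Sum>y\<in>Y. F y * G x)"
      by (simp add: sum.cartesian_product case_prod_beta)
    then show ?thesis by (simp add: sum_product sum.swap[of _ Y X])
  qed
  also have "(\<Sum>q\<in>X \<times> Y. h (fst q) (snd q)) = (\<Sum>x\<in>X. \<Sum>y\<in>Y. h x y)"
    by (simp add: sum.cartesian_product case_prod_beta)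
  finally show ?thesis by (simp add: real_sqrt_mult F_def G_def)
qed

text \<open>\<open>P l x y z\<close> says that the line \<open>l\<close> passes close to \<open>(x, y, z)\<close>; within the box, such a line is
  almost parallel to the first axis.\<close>

lemma sum_shadow_le:
  fixes P :: "'a \<Rightarrow> int \<Rightarrow> int \<Rightarrow> int \<Rightarrow> bool"
  assumes fin: "finite L" "finite X" "finite Y" "finite Z"
    and close: "\<And>l x y z x' y' z'. l \<in> L \<Longrightarrow> x \<in> X \<Longrightarrow> x' \<in> X \<Longrightarrow> P l x y z \<Longrightarrow> P l x' y' z'
      \<Longrightarrow> \<bar>y - y'\<bar> \<le> int D \<and> \<bar>z - z'\<bar> \<le> int D"
  shows "(\<Sum>y\<in>Y. \<Sum>z\<in>Z. real (card {l \<in> L. \<exists>x\<in>X. P l x y z}))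
    \<le> (2 * real D + 1)\<^sup>2 * real (card {l \<in> L. \<exists>x\<in>X. \<exists>y\<in>Y. \<exists>z\<in>Z. P l x y z})"
proof -
  let ?L = "{l \<in> L. \<exists>x\<in>X. \<exists>y\<in>Y. \<exists>z\<in>Z. P l x y z}"
  let ?S = "\<lambda>l. {q \<in> Y \<times> Z. \<exists>x\<in>X. P l x (fst q) (snd q)}"
  have S: "card (?S l) \<le> (2 * D + 1)\<^sup>2" if l: "l \<in> ?L" for l
  proof -
    from l obtain x0 y0 z0 where 0: "l \<in> L" "x0 \<in> X" "P l x0 y0 z0" by blast
    \<comment> \<open>One incidence of \<open>l\<close> with the box pins all its others to a square
      of side \<open>2 * D + 1\<close> in the \<open>(y, z)\<close> plane.\<close>
    have "?S l \<subseteq> {y0 - int D..y0 + int D} \<times> {z0 - int D..z0 + int D}"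
    proof
      fix q assume "q \<in> ?S l"
      then obtain x where "x \<in> X" "P l x (fst q) (snd q)" by blast
      from close[OF 0(1) this(1) 0(2) this(2) 0(3)]
      show "q \<in> {y0 - int D..y0 + int D} \<times> {z0 - int D..z0 + int D}"
        by (cases q) auto
    qed
    then have "card (?S l) \<le> card ({y0 - int D..y0 + int D} \<times> {z0 - int D..z0 + int D})"
      by (intro card_mono) auto
    also have "\<dots> = (2 * D + 1)\<^sup>2"
    proof -
      have "nat (2 * int D + 1) = 2 * D + 1" by simp
      then show ?thesis by (simp add: card_cartesian_product power2_eq_square)
    qed
    finally show ?thesis .
  qed
  \<comment> \<open>Double counting: summing over lines first, each line contributes the number of
    points in its shadow, and lines that miss the box contribute nothing.\<close>
  have "(\<Sum>y\<in>Y. \<Sum>z\<in>Z. card {l \<in> L. \<exists>x\<in>X. P l x y z})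
      = (\<Sum>q\<in>Y \<times> Z. card {l \<in> L. \<exists>x\<in>X. P l x (fst q) (snd q)})"
    by (simp add: sum.cartesian_product case_prod_beta)
  also have "\<dots> = (\<Sum>q\<in>Y \<times> Z. \<Sum>l\<in>L. if \<exists>x\<in>X. P l x (fst q) (snd q) then 1 else 0)"
    using fin by (simp add: sum.If_cases Int_def)
  also have "\<dots> = (\<Sum>l\<in>L. \<Sum>q\<in>Y \<times> Z. if \<exists>x\<in>X. P l x (fst q) (snd q) then 1 else 0)"
    by (rule sum.swap)
  also have "\<dots> = (\<Sum>l\<in>L. card (?S l))"
    using fin by (simp add: sum.If_cases Int_def)
  also have "\<dots> = (\<Sum>l\<in>?L. card (?S l))"
    using fin by (intro sum.mono_neutral_right) (auto simp: card_eq_0_iff)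
  also have "\<dots> \<le> (\<Sum>l\<in>?L. (2 * D + 1)\<^sup>2)" by (intro sum_mono S)
  also have "\<dots> = (2 * D + 1)\<^sup>2 * card ?L" by simp
  finally have "real (\<Sum>y\<in>Y. \<Sum>z\<in>Z. card {l \<in> L. \<exists>x\<in>X. P l x y z}) \<le> real ((2 * D + 1)\<^sup>2 * card ?L)"
    by (rule of_nat_mono)
  then show ?thesis by (simp add: algebra_simps)
qed

section \<open>Lines near lattice points and induction on scales\<close>

text \<open>Distance is taken in the maximum norm, so that one parameter \<open>s\<close> serves
  three scalar conditions and rescaling or drift can be treated coordinate by coordinate.\<close>

definition near :: "nat \<Rightarrow> real^3 \<Rightarrow> real^3 \<Rightarrow> int \<Rightarrow> int \<Rightarrow> int \<Rightarrow> bool" where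
  "near c p u x y z \<longleftrightarrow> (\<exists>s. \<bar>p $ 1 + s * u $ 1 - of_int x\<bar> \<le> real c \<and>
     \<bar>p $ 2 + s * u $ 2 - of_int y\<bar> \<le> real c \<and> \<bar>p $ 3 + s * u $ 3 - of_int z\<bar> \<le> real c)"

text \<open>The vector is not normalised, since only its slopes against the \<open>i\<close>-th axis
  matter. The slope bound 1/M is matched to blocks of side \<open>M\<close>: over such a block a
  line drifts sideways by a bounded amount.\<close>

definition steep :: "nat \<Rightarrow> 3 \<Rightarrow> real^3 \<Rightarrow> bool" where
  "steep M i u \<longleftrightarrow> (\<forall>k. k \<noteq> i \<longrightarrow> real M * \<bar>u $ k\<bar> \<le> \<bar>u $ i\<bar>)"

text \<open>The main coordinate of the line changes by at most \<open>2 * c + M\<close> between the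
  two points, so the other one changes by at most \<open>2 * c / M + 1\<close>, hence by at most
  \<open>2 * c + 1\<close>. The two closeness errors in \<open>b\<close> and \<open>b'\<close> add
  another \<open>2 * c\<close>.\<close>

lemma steep_drift:
  fixes a b a' b' :: int
  assumes M: "2 \<le> M" "real M * \<bar>v\<bar> \<le> \<bar>u\<bar>"
    and 1: "\<bar>p + s * u - of_int a\<bar> \<le> real c" "\<bar>q + s * v - of_int b\<bar> \<le> real c"
    and 2: "\<bar>p + s' * u - of_int a'\<bar> \<le> real c" "\<bar>q + s' * v - of_int b'\<bar> \<le> real c"
    and a: "\<bar>a - a'\<bar> \<le> int M"
  shows "\<bar>b - b'\<bar> \<le> int (4 * c + 1)"
proof -
  have "\<bar>real_of_int a - real_of_int a'\<bar> \<le> real M" using a by linarith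
  moreover have "(s - s') * u = (p + s * u - of_int a) - (p + s' * u - of_int a') + (of_int a - of_int a')"
    by (simp add: algebra_simps)
  ultimately have u: "\<bar>(s - s') * u\<bar> \<le> 2 * real c + real M" using 1 2 by linarith
  have "real M * \<bar>(s - s') * v\<bar> = \<bar>s - s'\<bar> * (real M * \<bar>v\<bar>)" by (simp add: abs_mult)
  also have "\<dots> \<le> \<bar>s - s'\<bar> * \<bar>u\<bar>" using M by (intro mult_left_mono) auto
  also have "\<dots> \<le> 2 * real c + real M" using u by (simp add: abs_mult)
  also have "\<dots> \<le> real M * (2 * real c + 1)"
  proof -
    have "1 * real c \<le> real M * real c" using M by (intro mult_right_mono) auto
    then show ?thesis by (simp add: algebra_simps)
  qed
  finally have v: "\<bar>(s - s') * v\<bar> \<le> 2 * real c + 1" using M by simp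
  have "(s - s') * v = (q + s * v - of_int b) - (q + s' * v - of_int b') + (of_int b - of_int b')"
    by (simp add: algebra_simps)
  then have "\<bar>real_of_int b - real_of_int b'\<bar> \<le> 4 * real c + 1" using 1 2 v by linarith
  then have "real_of_int \<bar>b - b'\<bar> \<le> real_of_int (int (4 * c + 1))" by simp
  then show ?thesis by linarith
qed

text \<open>A lattice point of a block is off by less than \<open>M\<close> from the corner, and
  \<open>c + M \<le> M * c\<close> for \<open>M\<close> and \<open>c\<close> at least 2. After
  division by \<open>M\<close> the error is therefore again at most \<open>c\<close>, so the
  closeness constant does not grow with the number of scales. Base point and parameter are divided
  by \<open>M\<close>; the direction stays, and with it steepness.\<close>

lemma near_rescale:
  assumes M: "2 \<le> M" and c: "2 \<le> c" and near: "near c p u x y z"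
    and "x \<in> {int M * X..<int M * X + int M}" "y \<in> {int M * Y..<int M * Y + int M}"
      "z \<in> {int M * Z..<int M * Z + int M}"
  shows "near c (p /\<^sub>R real M) u X Y Z"
proof -
  have "1 * 1 \<le> (real M - 1) * (real c - 1)" using M c by (intro mult_mono) auto
  then have cM: "real c + real M \<le> real M * real c" by (simp add: algebra_simps)
  have key: "\<bar>q / real M + s / real M * v - of_int X\<bar> \<le> real c"
    if "\<bar>q + s * v - of_int x\<bar> \<le> real c" "x \<in> {int M * X..<int M * X + int M}" for q s v and x X :: int
  proof -
    have "real_of_int (int M * X) \<le> of_int x" "real_of_int x < of_int (int M * X + int M)"
      using that(2) by (simp_all only: of_int_le_iff of_int_less_iff) auto
    then have "\<bar>q + s * v - real M * of_int X\<bar> \<le> real M * real c" using that(1) cM by simp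
    moreover have "q + s * v - real M * of_int X = real M * (q / real M + s / real M * v - of_int X)"
      using M by (simp add: field_simps)
    ultimately have "real M * \<bar>q / real M + s / real M * v - of_int X\<bar> \<le> real M * real c"
      by (simp add: abs_mult)
    then show ?thesis using M by simp
  qed
  from near obtain s where "\<bar>p $ 1 + s * u $ 1 - of_int x\<bar> \<le> real c"
     "\<bar>p $ 2 + s * u $ 2 - of_int y\<bar> \<le> real c" "\<bar>p $ 3 + s * u $ 3 - of_int z\<bar> \<le> real c"
    unfolding near_def by blast
  with key assms(4-6) show ?thesis unfolding near_def
    by (intro exI[of _ "s / real M"]) (simp add: divide_inverse_commute)
qed

text \<open>Half-open intervals tile exactly, and flooring division by \<open>M\<close> gives the
  index of the block for negative integers too.\<close>

lemma sum_blocks: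
  fixes F :: "int \<Rightarrow> 'b::comm_monoid_add"
  assumes "0 < M"
  shows "(\<Sum>x = - (int M * K)..<int M * K. F x) = (\<Sum>X = - K..<K. \<Sum>x = int M * X..<int M * X + int M. F x)"
proof -
  have "(\<Sum>X = - K..<K. \<Sum>x = int M * X..<int M * X + int M. F x)
     = (\<Sum>q\<in>(SIGMA X:{- K..<K}. {int M * X..<int M * X + int M}). F (snd q))"
    by (simp add: sum.Sigma case_prod_beta)
  also have "\<dots> = (\<Sum>x = - (int M * K)..<int M * K. F x)"
  proof (rule sum.reindex_bij_witness[of _ "\<lambda>x. (x div int M, x)" snd])
    fix q assume q: "q \<in> (SIGMA X:{- K..<K}. {int M * X..<int M * X + int M})"
    obtain X x where [simp]: "q = (X, x)" by (cases q)
    have X: "- K \<le> X" "X + 1 \<le> K" and x: "int M * X \<le> x" "x < int M * (X + 1)"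
      using q by (auto simp: algebra_simps)
    have "x div int M = X"
      using x by (intro int_div_pos_eq[of _ _ _ "x - int M * X"]) (auto simp: algebra_simps)
    then show "(snd q div int M, snd q) = q" by simp
    have "int M * (- K) \<le> int M * X" "int M * (X + 1) \<le> int M * K"
      using X by (auto intro!: mult_left_mono simp del: mult_minus_right)
    then show "snd q \<in> {- (int M * K)..<int M * K}" using x by auto
  next
    fix x assume x: "x \<in> {- (int M * K)..<int M * K}"
    have "0 \<le> x mod int M" "x mod int M < int M" using assms by simp_all
    moreover have "x = int M * (x div int M) + x mod int M" by simp
    ultimately have 1: "int M * (x div int M) \<le> x" "x < int M * (x div int M) + int M" by linarith+
    have "int M * (x div int M) < int M * K"
      using le_less_trans[OF 1(1)] x by simp
    \<comment> \<open>The strict form with \<open>+ 1\<close> is what cancelling \<open>M\<close>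
      needs; over the integers it then gives the lower bound
      \<open>- K \<le> x div int M\<close>.\<close>
    moreover have "int M * (- K) < int M * (x div int M + 1)"
    proof (rule le_less_trans)
      show "int M * (- K) \<le> x" using x by simp
      show "x < int M * (x div int M + 1)" using 1(2) by (simp add: distrib_left)
    qed
    ultimately have "x div int M < K" "- K < x div int M + 1"
      using assms by (simp_all only: mult_less_cancel_left_pos of_nat_0_less_iff)
    then show "(x div int M, x) \<in> (SIGMA X:{- K..<K}. {int M * X..<int M * X + int M})"
      using 1 by auto
  qed auto
  finally show ?thesis by simp
qed

text \<open>One scale of the induction. Inside a block, lines steep in one direction are counted
  through their shadows along that axis, to which Loomis-Whitney applies. The shadow of a line has
  at most \<open>(8 * c + 3)\<^sup>2\<close> points, and every line with a shadow is near the
  rescaled block corner. The cost is independent of \<open>M\<close>.\<close>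

lemma cube_step:
  fixes p1 p2 p3 u1 u2 u3 :: "'a \<Rightarrow> real^3"
  assumes M: "2 \<le> M" and c: "2 \<le> c" and fin: "finite L1" "finite L2" "finite L3"
    and steep: "\<forall>l\<in>L1. steep M 1 (u1 l)" "\<forall>l\<in>L2. steep M 2 (u2 l)" "\<forall>l\<in>L3. steep M 3 (u3 l)"
  shows "(\<Sum>x = int M * X..<int M * X + int M. \<Sum>y = int M * Y..<int M * Y + int M.
      \<Sum>z = int M * Z..<int M * Z + int M.
        sqrt (real (card {l\<in>L1. near c (p1 l) (u1 l) x y z})) *
        sqrt (real (card {l\<in>L2. near c (p2 l) (u2 l) x y z})) *
        sqrt (real (card {l\<in>L3. near c (p3 l) (u3 l) x y z})))
    \<le> (8 * real c + 3) ^ 3 *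
       (sqrt (real (card {l\<in>L1. near c (p1 l /\<^sub>R real M) (u1 l) X Y Z})) *
        sqrt (real (card {l\<in>L2. near c (p2 l /\<^sub>R real M) (u2 l) X Y Z})) *
        sqrt (real (card {l\<in>L3. near c (p3 l /\<^sub>R real M) (u3 l) X Y Z})))"
    (is "?lhs \<le> _ * (sqrt (real ?N1) * sqrt (real ?N2) * sqrt (real ?N3))")
proof -
  define A where "A = {int M * X..<int M * X + int M}"
  define B where "B = {int M * Y..<int M * Y + int M}"
  define C where "C = {int M * Z..<int M * Z + int M}"
  have ABC: "finite A" "finite B" "finite C" by (simp_all add: A_def B_def C_def)
  define f where "f y z = real (card {l\<in>L1. \<exists>x\<in>A. near c (p1 l) (u1 l) x y z})" for y z
  define g where "g x z = real (card {l\<in>L2. \<exists>y\<in>B. near c (p2 l) (u2 l) x y z})" for x z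
  define h where "h x y = real (card {l\<in>L3. \<exists>z\<in>C. near c (p3 l) (u3 l) x y z})" for x y
  let ?D = "4 * c + 1"
  have f: "(\<Sum>y\<in>B. \<Sum>z\<in>C. f y z) \<le> (2 * real ?D + 1)\<^sup>2 * real ?N1"
  proof -
    have "(\<Sum>y\<in>B. \<Sum>z\<in>C. f y z) \<le> (2 * real ?D + 1)\<^sup>2 *
        real (card {l \<in> L1. \<exists>x\<in>A. \<exists>y\<in>B. \<exists>z\<in>C. near c (p1 l) (u1 l) x y z})"
      unfolding f_def
    proof (rule sum_shadow_le[OF fin(1) ABC])
      fix l x y z x' y' z'
      assume l: "l \<in> L1" "x \<in> A" "x' \<in> A" "near c (p1 l) (u1 l) x y z" "near c (p1 l) (u1 l) x' y' z'"
      have "real M * \<bar>u1 l $ 2\<bar> \<le> \<bar>u1 l $ 1\<bar>" "real M * \<bar>u1 l $ 3\<bar> \<le> \<bar>u1 l $ 1\<bar>"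
        using steep(1) l(1) by (auto simp: steep_def)
      moreover have "\<bar>x - x'\<bar> \<le> int M" using l(2,3) by (auto simp: A_def)
      ultimately show "\<bar>y - y'\<bar> \<le> int ?D \<and> \<bar>z - z'\<bar> \<le> int ?D"
        using l(4,5) M unfolding near_def by (blast intro: steep_drift)
    qed
    also have "\<dots> \<le> (2 * real ?D + 1)\<^sup>2 * real ?N1"
      using fin by (intro mult_left_mono of_nat_mono card_mono)
        (auto simp: A_def B_def C_def intro!: near_rescale[OF M c])
    finally show ?thesis .
  qed
  have g: "(\<Sum>x\<in>A. \<Sum>z\<in>C. g x z) \<le> (2 * real ?D + 1)\<^sup>2 * real ?N2"
  proof -
    have "(\<Sum>x\<in>A. \<Sum>z\<in>C. g x z) \<le> (2 * real ?D + 1)\<^sup>2 *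
        real (card {l \<in> L2. \<exists>y\<in>B. \<exists>x\<in>A. \<exists>z\<in>C. near c (p2 l) (u2 l) x y z})"
      unfolding g_def
    proof (rule sum_shadow_le[OF fin(2) ABC(2,1,3)])
      fix l x y z x' y' z'
      assume l: "l \<in> L2" "y \<in> B" "y' \<in> B" "near c (p2 l) (u2 l) x y z" "near c (p2 l) (u2 l) x' y' z'"
      have "real M * \<bar>u2 l $ 1\<bar> \<le> \<bar>u2 l $ 2\<bar>" "real M * \<bar>u2 l $ 3\<bar> \<le> \<bar>u2 l $ 2\<bar>"
        using steep(2) l(1) by (auto simp: steep_def)
      moreover have "\<bar>y - y'\<bar> \<le> int M" using l(2,3) by (auto simp: B_def)
      ultimately show "\<bar>x - x'\<bar> \<le> int ?D \<and> \<bar>z - z'\<bar> \<le> int ?D"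
        using l(4,5) M unfolding near_def by (blast intro: steep_drift)
    qed
    also have "\<dots> \<le> (2 * real ?D + 1)\<^sup>2 * real ?N2"
      using fin by (intro mult_left_mono of_nat_mono card_mono)
        (auto simp: A_def B_def C_def intro!: near_rescale[OF M c])
    finally show ?thesis .
  qed
  have h: "(\<Sum>x\<in>A. \<Sum>y\<in>B. h x y) \<le> (2 * real ?D + 1)\<^sup>2 * real ?N3"
  proof -
    have "(\<Sum>x\<in>A. \<Sum>y\<in>B. h x y) \<le> (2 * real ?D + 1)\<^sup>2 *
        real (card {l \<in> L3. \<exists>z\<in>C. \<exists>x\<in>A. \<exists>y\<in>B. near c (p3 l) (u3 l) x y z})"
      unfolding h_def
    proof (rule sum_shadow_le[OF fin(3) ABC(3,1,2)])
      fix l x y z x' y' z'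
      assume l: "l \<in> L3" "z \<in> C" "z' \<in> C" "near c (p3 l) (u3 l) x y z" "near c (p3 l) (u3 l) x' y' z'"
      have "real M * \<bar>u3 l $ 1\<bar> \<le> \<bar>u3 l $ 3\<bar>" "real M * \<bar>u3 l $ 2\<bar> \<le> \<bar>u3 l $ 3\<bar>"
        using steep(3) l(1) by (auto simp: steep_def)
      moreover have "\<bar>z - z'\<bar> \<le> int M" using l(2,3) by (auto simp: C_def)
      ultimately show "\<bar>x - x'\<bar> \<le> int ?D \<and> \<bar>y - y'\<bar> \<le> int ?D"
        using l(4,5) M unfolding near_def by (blast intro: steep_drift)
    qed
    also have "\<dots> \<le> (2 * real ?D + 1)\<^sup>2 * real ?N3"
      using fin by (intro mult_left_mono of_nat_mono card_mono)
        (auto simp: A_def B_def C_def intro!: near_rescale[OF M c])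
    finally show ?thesis .
  qed
  \<comment> \<open>Replacing nearness to a point by nearness to some point of the axis-parallel
    fibre through it removes one variable from each factor.\<close>
  have "?lhs \<le> (\<Sum>x\<in>A. \<Sum>y\<in>B. \<Sum>z\<in>C. sqrt (f y z) * sqrt (g x z) * sqrt (h x y))"
    unfolding A_def[symmetric] B_def[symmetric] C_def[symmetric]
    by (intro sum_mono mult_mono real_sqrt_le_mono mult_nonneg_nonneg)
      (auto simp: f_def g_def h_def fin intro!: card_mono)
  also have "\<dots> \<le> sqrt (\<Sum>y\<in>B. \<Sum>z\<in>C. f y z) * sqrt (\<Sum>x\<in>A. \<Sum>z\<in>C. g x z) * sqrt (\<Sum>x\<in>A. \<Sum>y\<in>B. h x y)"
    by (rule discrete_loomis_whitney) (simp_all add: f_def g_def h_def)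
  \<comment> \<open>Each square root releases one factor
    \<open>2 * (4 * c + 1) + 1 = 8 * c + 3\<close>, which gives the cube in the claim.\<close>
  also have "\<dots> \<le> sqrt ((2 * real ?D + 1)\<^sup>2 * real ?N1) * sqrt ((2 * real ?D + 1)\<^sup>2 * real ?N2)
      * sqrt ((2 * real ?D + 1)\<^sup>2 * real ?N3)"
    using f g h
    by (intro mult_mono real_sqrt_le_mono mult_nonneg_nonneg) (auto simp: f_def g_def h_def intro!: sum_nonneg)
  also have "\<dots> = (8 * real c + 3) ^ 3 * (sqrt (real ?N1) * sqrt (real ?N2) * sqrt (real ?N3))"
    by (simp add: real_sqrt_mult power3_eq_cube algebra_simps)
  finally show ?thesis .
qed

text \<open>Induction on the number of scales, with base points arbitrary because each step divides
  them by \<open>M\<close>. A range of side comparable to \<open>M ^ n\<close> thus costs a constant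
  to the power \<open>n\<close>.\<close>

lemma discrete_kakeya:
  fixes p1 p2 p3 u1 u2 u3 :: "'a \<Rightarrow> real^3"
  assumes M: "2 \<le> M" and c: "2 \<le> c" and fin: "finite L1" "finite L2" "finite L3"
    and steep: "\<forall>l\<in>L1. steep M 1 (u1 l)" "\<forall>l\<in>L2. steep M 2 (u2 l)" "\<forall>l\<in>L3. steep M 3 (u3 l)"
  shows "(\<Sum>x = - (int M ^ n)..<int M ^ n. \<Sum>y = - (int M ^ n)..<int M ^ n. \<Sum>z = - (int M ^ n)..<int M ^ n.
        sqrt (real (card {l\<in>L1. near c (p1 l) (u1 l) x y z})) *
        sqrt (real (card {l\<in>L2. near c (p2 l) (u2 l) x y z})) *
        sqrt (real (card {l\<in>L3. near c (p3 l) (u3 l) x y z})))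
    \<le> 8 * ((8 * real c + 3) ^ 3) ^ n *
       (sqrt (real (card L1)) * sqrt (real (card L2)) * sqrt (real (card L3)))"
proof (induction n arbitrary: p1 p2 p3)
  \<comment> \<open>At scale one each coordinate ranges over \<open>-1\<close> and \<open>0\<close>.
    The eight cells are estimated by counting all lines, which is the factor 8.\<close>
  case 0
  have "(\<Sum>x = - 1..<1::int. \<Sum>y = - 1..<1::int. \<Sum>z = - 1..<1::int.
        sqrt (real (card {l\<in>L1. near c (p1 l) (u1 l) x y z})) *
        sqrt (real (card {l\<in>L2. near c (p2 l) (u2 l) x y z})) *
        sqrt (real (card {l\<in>L3. near c (p3 l) (u3 l) x y z})))
    \<le> (\<Sum>x = - 1..<1::int. \<Sum>y = - 1..<1::int. \<Sum>z = - 1..<1::int.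
         sqrt (real (card L1)) * sqrt (real (card L2)) * sqrt (real (card L3)))"
    by (intro sum_mono mult_mono real_sqrt_le_mono mult_nonneg_nonneg of_nat_mono card_mono)
      (auto simp: fin)
  then show ?case by simp
next
  case (Suc n)
  let ?I = "{- (int M ^ n)..<int M ^ n}"
  let ?B = "\<lambda>X. {int M * X..<int M * X + int M}"
  let ?F = "\<lambda>x y z. sqrt (real (card {l\<in>L1. near c (p1 l) (u1 l) x y z})) *
        sqrt (real (card {l\<in>L2. near c (p2 l) (u2 l) x y z})) *
        sqrt (real (card {l\<in>L3. near c (p3 l) (u3 l) x y z}))"
  let ?G = "\<lambda>x y z. sqrt (real (card {l\<in>L1. near c (p1 l /\<^sub>R real M) (u1 l) x y z})) *
        sqrt (real (card {l\<in>L2. near c (p2 l /\<^sub>R real M) (u2 l) x y z})) *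
        sqrt (real (card {l\<in>L3. near c (p3 l /\<^sub>R real M) (u3 l) x y z}))"
  have M0: "0 < M" using M by simp
  have "(\<Sum>x = - (int M ^ Suc n)..<int M ^ Suc n. \<Sum>y = - (int M ^ Suc n)..<int M ^ Suc n.
      \<Sum>z = - (int M ^ Suc n)..<int M ^ Suc n. ?F x y z)
    = (\<Sum>X\<in>?I. \<Sum>x\<in>?B X. \<Sum>Y\<in>?I. \<Sum>y\<in>?B Y. \<Sum>Z\<in>?I. \<Sum>z\<in>?B Z. ?F x y z)"
    by (simp only: power_Suc sum_blocks[OF M0])
  \<comment> \<open>The three exchanges bring the block indices outside, so that
    \<open>cube_step\<close> applies to the inner triple sum.\<close>
  also have "\<dots> = (\<Sum>X\<in>?I. \<Sum>x\<in>?B X. \<Sum>Y\<in>?I. \<Sum>Z\<in>?I. \<Sum>y\<in>?B Y. \<Sum>z\<in>?B Z. ?F x y z)"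
    by (intro sum.cong refl sum.swap)
  also have "\<dots> = (\<Sum>X\<in>?I. \<Sum>Y\<in>?I. \<Sum>x\<in>?B X. \<Sum>Z\<in>?I. \<Sum>y\<in>?B Y. \<Sum>z\<in>?B Z. ?F x y z)"
    by (intro sum.cong refl sum.swap)
  also have "\<dots> = (\<Sum>X\<in>?I. \<Sum>Y\<in>?I. \<Sum>Z\<in>?I. \<Sum>x\<in>?B X. \<Sum>y\<in>?B Y. \<Sum>z\<in>?B Z. ?F x y z)"
    by (intro sum.cong refl sum.swap)
  also have "\<dots> \<le> (\<Sum>X\<in>?I. \<Sum>Y\<in>?I. \<Sum>Z\<in>?I. (8 * real c + 3) ^ 3 * ?G X Y Z)"
    by (intro sum_mono cube_step M c fin steep)
  also have "\<dots> = (8 * real c + 3) ^ 3 * (\<Sum>X\<in>?I. \<Sum>Y\<in>?I. \<Sum>Z\<in>?I. ?G X Y Z)"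
    by (simp add: sum_distrib_left)
  also have "\<dots> \<le> (8 * real c + 3) ^ 3 * (8 * ((8 * real c + 3) ^ 3) ^ n *
       (sqrt (real (card L1)) * sqrt (real (card L2)) * sqrt (real (card L3))))"
    by (intro mult_left_mono Suc.IH) simp
  finally show ?case by (simp add: algebra_simps)
qed

section \<open>From lattice points to integrals\<close>

lemma emeasure_lborel_cball_le:
  assumes "0 \<le> R"
  shows "emeasure lborel (cball (p :: real^3) R) \<le> ennreal (8 * R ^ 3)"
proof -
  have "cball p R \<subseteq> cbox (p - R *\<^sub>R One) (p + R *\<^sub>R One)"
  proof
    fix x assume "x \<in> cball p R"
    then have n: "norm (x - p) \<le> R" by (simp add: dist_norm norm_minus_commute)
    have "\<bar>(x - p) \<bullet> i\<bar> \<le> R" if "i \<in> Basis" for i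
      using Basis_le_norm[OF that, of "x - p"] n by linarith
    then show "x \<in> cbox (p - R *\<^sub>R One) (p + R *\<^sub>R One)"
      by (force simp: mem_box algebra_simps abs_le_iff)
  qed
  then have "emeasure lborel (cball p R) \<le> emeasure lborel (cbox (p - R *\<^sub>R One) (p + R *\<^sub>R One))"
    by (intro emeasure_mono) auto
  also have "\<dots> = ennreal (\<Prod>b\<in>Basis. ((p + R *\<^sub>R One) - (p - R *\<^sub>R One)) \<bullet> b)"
    using assms by (intro emeasure_lborel_cbox) (simp add: inner_add_left inner_diff_left)
  also have "(\<Prod>b\<in>Basis. ((p + R *\<^sub>R One) - (p - R *\<^sub>R One)) \<bullet> b) = (\<Prod>b\<in>(Basis :: (real^3) set). 2 * R)"
  proof (rule prod.cong[OF refl])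
    fix b :: "real^3" assume "b \<in> Basis"
    then show "((p + R *\<^sub>R One) - (p - R *\<^sub>R One)) \<bullet> b = 2 * R"
      by (simp only: inner_add_left inner_diff_left inner_scaleR_left inner_sum_Basis)
  qed
  also have "\<dots> = 8 * R ^ 3" by (simp add: power_mult_distrib)
  finally show ?thesis .
qed

text \<open>Axis parameters belonging to points of \<open>X\<close> differ by at most
  \<open>H\<close>, so balls of radius 5 centred at unit parameter steps cover \<open>X\<close>.
  There are at most \<open>2 * H + 4\<close> of them, each of volume at most
  \<open>8 * 5 ^ 3 = 1000\<close>.\<close>

lemma emeasure_tube_segment_le:
  fixes p u :: "real^3"
  assumes u: "norm u \<le> 3" and H: "0 \<le> H"
    and tube: "\<And>x. x \<in> X \<Longrightarrow> \<exists>s. norm (x - (p + s *\<^sub>R u)) \<le> 2"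
    and short: "\<And>x x' s s'. x \<in> X \<Longrightarrow> x' \<in> X \<Longrightarrow> norm (x - (p + s *\<^sub>R u)) \<le> 2 \<Longrightarrow>
      norm (x' - (p + s' *\<^sub>R u)) \<le> 2 \<Longrightarrow> \<bar>s - s'\<bar> \<le> H"
  shows "emeasure lborel X \<le> ennreal (5000 * (H + 1))"
proof (cases "X = {}")
  case False
  then obtain x0 s0 where x0: "x0 \<in> X" "norm (x0 - (p + s0 *\<^sub>R u)) \<le> 2"
    using tube by blast
  define N where "N = nat \<lceil>H\<rceil>"
  define J where "J = {- int N - 1..int N}"
  have N: "H \<le> real N" "real N \<le> H + 1" unfolding N_def using H by linarith+
  have "X \<subseteq> (\<Union>i\<in>J. cball (p + (s0 + of_int i) *\<^sub>R u) 5)"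
  proof
    fix x assume x: "x \<in> X"
    with tube obtain s where s: "norm (x - (p + s *\<^sub>R u)) \<le> 2" by blast
    have "\<bar>s - s0\<bar> \<le> H" by (rule short[OF x x0(1) s x0(2)])
    then have "\<bar>s - s0\<bar> \<le> real N" using N by simp
    then have J: "\<lfloor>s - s0\<rfloor> \<in> J" unfolding J_def by (simp add: le_floor_iff floor_le_iff abs_le_iff)
    have "norm (x - (p + (s0 + of_int \<lfloor>s - s0\<rfloor>) *\<^sub>R u))
        = norm ((x - (p + s *\<^sub>R u)) + (s - s0 - of_int \<lfloor>s - s0\<rfloor>) *\<^sub>R u)"
      by (simp add: algebra_simps)
    also have "\<dots> \<le> norm (x - (p + s *\<^sub>R u)) + \<bar>s - s0 - of_int \<lfloor>s - s0\<rfloor>\<bar> * norm u"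
      by (rule order.trans[OF norm_triangle_ineq]) simp
    \<comment> \<open>The distance to the axis is at most 2, and rounding the parameter moves the
      centre by at most \<open>norm u \<le> 3\<close>; hence the radius 5.\<close>
    also have "\<dots> \<le> 2 + 1 * 3"
      using s u by (intro add_mono mult_mono) (auto simp: abs_le_iff, linarith+)
    finally show "x \<in> (\<Union>i\<in>J. cball (p + (s0 + of_int i) *\<^sub>R u) 5)"
      using J by (auto simp: dist_norm norm_minus_commute intro!: bexI[of _ "\<lfloor>s - s0\<rfloor>"])
  qed
  then have "emeasure lborel X \<le> emeasure lborel (\<Union>i\<in>J. cball (p + (s0 + of_int i) *\<^sub>R u) 5)"
    by (intro emeasure_mono) auto
  also have "\<dots> \<le> (\<Sum>i\<in>J. emeasure lborel (cball (p + (s0 + of_int i) *\<^sub>R u) 5))"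
    by (intro emeasure_subadditive_finite) (auto simp: J_def)
  also have "\<dots> \<le> (\<Sum>i\<in>J. ennreal 1000)"
    using emeasure_lborel_cball_le[of 5] by (intro sum_mono) simp
  also have "\<dots> = ennreal (real (card J) * 1000)"
    by (simp add: ennreal_mult ennreal_of_nat_eq_real_of_nat)
  also have "\<dots> \<le> ennreal (5000 * (H + 1))"
    using N H by (intro ennreal_leI) (simp add: J_def nat_add_distrib)
  finally show ?thesis .
qed simp

section \<open>Cauchy-Schwarz on one cell and summation over cells\<close>

text \<open>The weighted form is linear in \<open>x\<close> and \<open>y\<close>, so it can be
  integrated term by term; optimising the weight afterwards recovers Cauchy-Schwarz for
  integrals.\<close>

lemma sqrt_mult_sqrt_le_weighted:
  assumes "0 \<le> x" "0 \<le> y" "0 < \<mu>"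
  shows "sqrt x * sqrt y \<le> \<mu> / 2 * x + 1 / (2 * \<mu>) * (y::real)"
proof -
  have "sqrt x * sqrt y = sqrt ((\<mu> * x) * (y / \<mu>))"
    using assms by (simp add: real_sqrt_mult[symmetric])
  also have "\<dots> \<le> (\<mu> * x + y / \<mu>) / 2"
    using assms by (intro arith_geo_mean_sqrt) auto
  finally show ?thesis using assms by (simp add: field_simps)
qed

lemma nn_integral_cell_le:
  fixes L1 L2 L3 :: "'a set set"
  assumes fin: "finite L1" "finite L2" "finite L3"
    and meas: "\<And>T. T \<in> L1 \<union> L2 \<union> L3 \<Longrightarrow> T \<in> sets M" "Q \<in> sets M"
    and ab: "0 < a" "0 < b"
    and a: "\<And>S T. S \<in> L1 \<Longrightarrow> T \<in> L2 \<Longrightarrow> emeasure M (S \<inter> T) \<le> ennreal a"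
    and b: "\<And>T. T \<in> L3 \<Longrightarrow> emeasure M (T \<inter> Q) \<le> ennreal b"
  shows "(\<integral>\<^sup>+x\<in>Q. ennreal (sqrt (\<Sum>T\<in>L1. indicator T x) * sqrt (\<Sum>T\<in>L2. indicator T x) *
      sqrt (\<Sum>T\<in>L3. indicator T x)) \<partial>M)
    \<le> ennreal (sqrt (a * b) * (sqrt (card L1) * sqrt (card L2) * sqrt (card L3)))"
\<comment> \<open>With an empty family the integrand vanishes. Otherwise all cardinalities are
  positive and the weight below is well defined and positive.\<close>
proof (cases "L1 = {} \<or> L2 = {} \<or> L3 = {}")
  case True
  then have "(\<lambda>x. ennreal (sqrt (\<Sum>T\<in>L1. indicator T x) * sqrt (\<Sum>T\<in>L2. indicator T x) *
      sqrt (\<Sum>T\<in>L3. indicator T x)) * indicator Q x) = (\<lambda>x. 0)" by (auto simp: fun_eq_iff)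
  then show ?thesis by (simp add: zero_le)
next
  case False
  define n1 where "n1 = real (card L1)"
  define n2 where "n2 = real (card L2)"
  define n3 where "n3 = real (card L3)"
  have n: "0 < n1" "0 < n2" "0 < n3"
    using False fin by (auto simp: n1_def n2_def n3_def card_gt_0_iff)
  \<comment> \<open>This weight balances the pair term \<open>\<mu> / 2 * (n1 * n2 * a)\<close>
    against the single term \<open>n3 * b / (2 * \<mu>)\<close>; each is then half of the geometric
    mean bound.\<close>
  define \<mu> where "\<mu> = sqrt (n3 * b) / sqrt (n1 * n2 * a)"
  have \<mu>: "0 < \<mu>" using n ab by (simp add: \<mu>_def)
  have pw: "ennreal (sqrt (\<Sum>T\<in>L1. indicator T x) * sqrt (\<Sum>T\<in>L2. indicator T x) *
      sqrt (\<Sum>T\<in>L3. indicator T x)) * indicator Q x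
    \<le> (\<Sum>S\<in>L1. \<Sum>T\<in>L2. ennreal (\<mu> / 2) * indicator (S \<inter> T) x) +
      (\<Sum>T\<in>L3. ennreal (1 / (2 * \<mu>)) * indicator (T \<inter> Q) x)" for x
  proof (cases "x \<in> Q")
    case True
    have e: "ennreal t * indicator T x = ennreal (t * indicator T x)" for t and T :: "'a set"
      by (simp add: indicator_def)
    have "sqrt (\<Sum>T\<in>L1. indicator T x) * sqrt (\<Sum>T\<in>L2. indicator T x) * sqrt (\<Sum>T\<in>L3. indicator T x)
      = sqrt ((\<Sum>T\<in>L1. indicator T x) * (\<Sum>T\<in>L2. indicator T x)) * sqrt (\<Sum>T\<in>L3. indicator T x)"
      by (simp add: real_sqrt_mult)
    also have "\<dots> \<le> \<mu> / 2 * ((\<Sum>T\<in>L1. indicator T x) * (\<Sum>T\<in>L2. indicator T x)) +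
        1 / (2 * \<mu>) * (\<Sum>T\<in>L3. indicator T x)"
      using \<mu> by (intro sqrt_mult_sqrt_le_weighted mult_nonneg_nonneg sum_nonneg) auto
    \<comment> \<open>Only the third family keeps the restriction to \<open>Q\<close>; the pair term
      is integrated over the whole space, where transversality already bounds
      \<open>S \<inter> T\<close>.\<close>
    also have "\<dots> = (\<Sum>S\<in>L1. \<Sum>T\<in>L2. \<mu> / 2 * indicator (S \<inter> T) x) + (\<Sum>T\<in>L3. 1 / (2 * \<mu>) * indicator (T \<inter> Q) x)"
    proof -
      have "(\<Sum>T\<in>L1. indicator T x) * (\<Sum>T\<in>L2. indicator T x) = (\<Sum>S\<in>L1. \<Sum>T\<in>L2. indicator (S \<inter> T) x :: real)"
        by (simp only: sum_product indicator_inter_arith)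
      moreover have "(\<Sum>T\<in>L3. indicator T x) = (\<Sum>T\<in>L3. indicator (T \<inter> Q) x :: real)"
        using True by (simp only: indicator_inter_arith) simp
      ultimately show ?thesis by (simp only: sum_distrib_left)
    qed
    finally have "ennreal (sqrt (\<Sum>T\<in>L1. indicator T x) * sqrt (\<Sum>T\<in>L2. indicator T x) *
        sqrt (\<Sum>T\<in>L3. indicator T x)) \<le> ennreal \<dots>"
      by (rule ennreal_leI)
    also have "\<dots> = (\<Sum>S\<in>L1. \<Sum>T\<in>L2. ennreal (\<mu> / 2) * indicator (S \<inter> T) x) +
      (\<Sum>T\<in>L3. ennreal (1 / (2 * \<mu>)) * indicator (T \<inter> Q) x)"
      using \<mu> unfolding e by (simp add: sum_nonneg ennreal_plus[symmetric] del: ennreal_plus)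
    finally show ?thesis using True by simp
  qed simp
  have "(\<integral>\<^sup>+x\<in>Q. ennreal (sqrt (\<Sum>T\<in>L1. indicator T x) * sqrt (\<Sum>T\<in>L2. indicator T x) *
      sqrt (\<Sum>T\<in>L3. indicator T x)) \<partial>M)
    \<le> (\<integral>\<^sup>+x. (\<Sum>S\<in>L1. \<Sum>T\<in>L2. ennreal (\<mu> / 2) * indicator (S \<inter> T) x) +
      (\<Sum>T\<in>L3. ennreal (1 / (2 * \<mu>)) * indicator (T \<inter> Q) x) \<partial>M)"
    by (intro nn_integral_mono pw)
  also have "\<dots> = (\<Sum>S\<in>L1. \<Sum>T\<in>L2. ennreal (\<mu> / 2) * emeasure M (S \<inter> T)) +
      (\<Sum>T\<in>L3. ennreal (1 / (2 * \<mu>)) * emeasure M (T \<inter> Q))"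
    using meas by (subst nn_integral_add; (subst nn_integral_sum)?; (subst nn_integral_sum)?)
      (auto intro!: sum.cong arg_cong2[of _ _ _ _ "(+)"] simp: nn_integral_cmult_indicator nn_integral_sum)
  also have "\<dots> \<le> (\<Sum>S\<in>L1. \<Sum>T\<in>L2. ennreal (\<mu> / 2) * ennreal a) + (\<Sum>T\<in>L3. ennreal (1 / (2 * \<mu>)) * ennreal b)"
    by (intro add_mono sum_mono mult_left_mono a b) auto
  also have "\<dots> = ennreal (n1 * (n2 * (\<mu> / 2 * a)) + n3 * (1 / (2 * \<mu>) * b))"
    using \<mu> ab n
    by (simp add: n1_def n2_def n3_def ennreal_mult[symmetric] ennreal_plus[symmetric] ennreal_of_nat_eq_real_of_nat
        del: ennreal_plus)
  also have "n1 * (n2 * (\<mu> / 2 * a)) + n3 * (1 / (2 * \<mu>) * b) = sqrt (n1 * n2 * a) * sqrt (n3 * b)"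
  proof -
    define P where "P = sqrt (n1 * n2 * a)"
    define R where "R = sqrt (n3 * b)"
    have PR: "P > 0" "R > 0" "P * P = n1 * n2 * a" "R * R = n3 * b" using n ab by (simp_all add: P_def R_def)
    have \<mu>': "\<mu> = R / P" by (simp add: \<mu>_def P_def R_def)
    have "n1 * (n2 * (\<mu> / 2 * a)) + n3 * (1 / (2 * \<mu>) * b) = \<mu> / 2 * (P * P) + 1 / (2 * \<mu>) * (R * R)"
      unfolding PR by (simp add: algebra_simps)
    also have "\<dots> = P * R" unfolding \<mu>' using PR(1,2) by (simp add: field_simps)
    finally show ?thesis unfolding P_def R_def .
  qed
  also have "\<dots> = sqrt (a * b) * (sqrt (card L1) * sqrt (card L2) * sqrt (card L3))"
    by (simp add: n1_def n2_def n3_def real_sqrt_mult)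
  finally show ?thesis .
qed

lemma sum_indicator_subset:
  assumes "finite A" "B \<subseteq> A" "\<And>T. T \<in> A \<Longrightarrow> x \<in> T \<Longrightarrow> T \<in> B"
  shows "(\<Sum>T\<in>A. indicator T x) = (\<Sum>T\<in>B. indicator T x :: real)"
  using assms by (intro sum.mono_neutral_right) (auto simp: indicator_def)

text \<open>Space is cut into preimages of lattice unit cubes under \<open>\<Phi>\<close>. On each
  of them only tubes whose image line is near the lattice point are seen, and the cell estimate
  contributes the same factor \<open>sqrt (a * b)\<close>. This factor comes out of the sum once,
  and \<open>discrete_kakeya\<close> controls the rest.\<close>

lemma integral_of_steep_tubes_le:
  fixes F1 F2 F3 :: "(real^3) set set" and \<Phi> :: "real^3 \<Rightarrow> real^3"
    and p1 p2 p3 u1 u2 u3 :: "(real^3) set \<Rightarrow> real^3"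
  assumes lin: "linear \<Phi>" and bound: "\<And>x k. \<bar>\<Phi> x $ k\<bar> \<le> B * norm x"
    and M: "2 \<le> M" and c: "2 \<le> c" "1 + 2 * B \<le> real c"
    and fin: "finite F1" "finite F2" "finite F3"
    and meas: "\<And>T. T \<in> F1 \<union> F2 \<union> F3 \<Longrightarrow> T \<in> sets borel"
    and tube1: "\<And>T x. T \<in> F1 \<Longrightarrow> x \<in> T \<Longrightarrow> \<exists>s. norm (x - (p1 T + s *\<^sub>R u1 T)) \<le> 2"
    and tube2: "\<And>T x. T \<in> F2 \<Longrightarrow> x \<in> T \<Longrightarrow> \<exists>s. norm (x - (p2 T + s *\<^sub>R u2 T)) \<le> 2"
    and tube3: "\<And>T x. T \<in> F3 \<Longrightarrow> x \<in> T \<Longrightarrow> \<exists>s. norm (x - (p3 T + s *\<^sub>R u3 T)) \<le> 2"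
    and steep: "\<forall>T\<in>F1. steep M 1 (\<Phi> (u1 T))" "\<forall>T\<in>F2. steep M 2 (\<Phi> (u2 T))" "\<forall>T\<in>F3. steep M 3 (\<Phi> (u3 T))"
    and ab: "0 < a" "0 < b"
    and a: "\<And>S T. S \<in> F1 \<Longrightarrow> T \<in> F2 \<Longrightarrow> emeasure lborel (S \<inter> T) \<le> ennreal a"
    and b: "\<And>T z. T \<in> F3 \<Longrightarrow> emeasure lborel {x \<in> T. \<lfloor>\<Phi> x $ 3\<rfloor> = z} \<le> ennreal b"
    and R: "B * R \<le> real M ^ n" and B: "0 < B"
  shows "(\<integral>\<^sup>+x\<in>ball 0 R. ennreal (sqrt (\<Sum>T\<in>F1. indicator T x) * sqrt (\<Sum>T\<in>F2. indicator T x) *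
      sqrt (\<Sum>T\<in>F3. indicator T x)) \<partial>lborel)
    \<le> ennreal (8 * ((8 * real c + 3) ^ 3) ^ n * sqrt (a * b) *
        (sqrt (card F1) * sqrt (card F2) * sqrt (card F3)))"
proof -
  let ?I = "{- (int M ^ n)..<int M ^ n}"
  let ?g = "\<lambda>x. sqrt (\<Sum>T\<in>F1. indicator T x) * sqrt (\<Sum>T\<in>F2. indicator T x) * sqrt (\<Sum>T\<in>F3. indicator T x)"
  define Q where "Q i j k = {v. \<lfloor>\<Phi> v $ 1\<rfloor> = i \<and> \<lfloor>\<Phi> v $ 2\<rfloor> = j \<and> \<lfloor>\<Phi> v $ 3\<rfloor> = k}" for i j k
  define L1 where "L1 i j k = {T\<in>F1. near c (\<Phi> (p1 T)) (\<Phi> (u1 T)) i j k}" for i j k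
  define L2 where "L2 i j k = {T\<in>F2. near c (\<Phi> (p2 T)) (\<Phi> (u2 T)) i j k}" for i j k
  define L3 where "L3 i j k = {T\<in>F3. near c (\<Phi> (p3 T)) (\<Phi> (u3 T)) i j k}" for i j k
  have [measurable]: "\<Phi> \<in> borel_measurable borel"
    using lin by (intro borel_measurable_continuous_onI linear_continuous_on linear_conv_bounded_linear[THEN iffD1])
  have [measurable]: "(\<lambda>v. \<Phi> v $ k) \<in> borel_measurable borel" for k
    using lin by (intro borel_measurable_continuous_onI continuous_on_component linear_continuous_on linear_conv_bounded_linear[THEN iffD1])
  have Qm[measurable]: "Q i j k \<in> sets borel" for i j k
    unfolding Q_def floor_eq_iff by measurable
  have nearI: "near c (\<Phi> p) (\<Phi> u) i j k" if "v \<in> Q i j k" "norm (v - (p + s *\<^sub>R u)) \<le> 2" for v p u s i j k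
  proof -
    have "\<bar>\<Phi> p $ l + s * \<Phi> u $ l - of_int e\<bar> \<le> real c" if e: "\<lfloor>\<Phi> v $ l\<rfloor> = e" for l e
    proof -
      have "\<Phi> (v - (p + s *\<^sub>R u)) $ l = \<Phi> v $ l - (\<Phi> p $ l + s * \<Phi> u $ l)"
        using lin by (simp add: linear_diff linear_add linear_scale)
      then have "\<bar>\<Phi> v $ l - (\<Phi> p $ l + s * \<Phi> u $ l)\<bar> \<le> B * norm (v - (p + s *\<^sub>R u))"
        using bound[of "v - (p + s *\<^sub>R u)" l] by simp
      \<comment> \<open>A tube of radius 2 has an image within \<open>2 * B\<close> of the image
        line in each coordinate, and passing to the integer part costs at most 1 more; this is the
        condition \<open>1 + 2 * B \<le> c\<close>.\<close>
      also have "\<dots> \<le> B * 2" using \<open>norm (v - (p + s *\<^sub>R u)) \<le> 2\<close> B by (intro mult_left_mono) auto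
      finally show ?thesis using e c by linarith
    qed
    then show ?thesis using that(1) unfolding near_def Q_def by blast
  qed
  have cell: "(\<integral>\<^sup>+x\<in>Q i j k. ennreal (?g x) \<partial>lborel)
     \<le> ennreal (sqrt (a * b) * (sqrt (card (L1 i j k)) * sqrt (card (L2 i j k)) * sqrt (card (L3 i j k))))" for i j k
  proof -
    have "ennreal (?g x) * indicator (Q i j k) x = ennreal (sqrt (\<Sum>T\<in>L1 i j k. indicator T x) *
       sqrt (\<Sum>T\<in>L2 i j k. indicator T x) * sqrt (\<Sum>T\<in>L3 i j k. indicator T x)) * indicator (Q i j k) x" for x
    proof (cases "x \<in> Q i j k")
      case True
      have "(\<Sum>T\<in>F1. indicator T x) = (\<Sum>T\<in>L1 i j k. indicator T x :: real)"
        using tube1 nearI[OF True] by (intro sum_indicator_subset fin) (auto simp: L1_def, blast)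
      moreover have "(\<Sum>T\<in>F2. indicator T x) = (\<Sum>T\<in>L2 i j k. indicator T x :: real)"
        using tube2 nearI[OF True] by (intro sum_indicator_subset fin) (auto simp: L2_def, blast)
      moreover have "(\<Sum>T\<in>F3. indicator T x) = (\<Sum>T\<in>L3 i j k. indicator T x :: real)"
        using tube3 nearI[OF True] by (intro sum_indicator_subset fin) (auto simp: L3_def, blast)
      ultimately show ?thesis by simp
    qed simp
    then have "(\<integral>\<^sup>+x\<in>Q i j k. ennreal (?g x) \<partial>lborel) =
      (\<integral>\<^sup>+x\<in>Q i j k. ennreal (sqrt (\<Sum>T\<in>L1 i j k. indicator T x) *
       sqrt (\<Sum>T\<in>L2 i j k. indicator T x) * sqrt (\<Sum>T\<in>L3 i j k. indicator T x)) \<partial>lborel)" by simp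
    also have "\<dots> \<le> ennreal (sqrt (a * b) * (sqrt (card (L1 i j k)) * sqrt (card (L2 i j k)) * sqrt (card (L3 i j k))))"
    proof (rule nn_integral_cell_le[OF _ _ _ _ _ ab])
      fix T assume T: "T \<in> L3 i j k"
      have "emeasure lborel (T \<inter> Q i j k) \<le> emeasure lborel {x \<in> T. \<lfloor>\<Phi> x $ 3\<rfloor> = k}"
      proof (rule emeasure_mono)
        have [measurable]: "T \<in> sets borel" using T meas by (auto simp: L3_def)
        show "{x \<in> T. \<lfloor>\<Phi> x $ 3\<rfloor> = k} \<in> sets lborel" unfolding floor_eq_iff by measurable
      qed (auto simp: Q_def)
      also have "\<dots> \<le> ennreal b" using T by (intro b) (auto simp: L3_def)
      finally show "emeasure lborel (T \<inter> Q i j k) \<le> ennreal b" .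
    qed (use fin meas a in \<open>auto simp: L1_def L2_def L3_def\<close>)
    finally show ?thesis .
  qed
  have gm[measurable]: "?g \<in> borel_measurable borel"
    using meas by (intro borel_measurable_times borel_measurable_sqrt borel_measurable_sum borel_measurable_indicator) auto
  have "(\<integral>\<^sup>+x\<in>ball 0 R. ennreal (?g x) \<partial>lborel)
     \<le> (\<integral>\<^sup>+x. (\<Sum>i\<in>?I. \<Sum>j\<in>?I. \<Sum>k\<in>?I. ennreal (?g x) * indicator (Q i j k) x) \<partial>lborel)"
  proof (intro nn_integral_mono)
    fix x :: "real^3"
    show "ennreal (?g x) * indicator (ball 0 R) x \<le> (\<Sum>i\<in>?I. \<Sum>j\<in>?I. \<Sum>k\<in>?I. ennreal (?g x) * indicator (Q i j k) x)"
    proof (cases "x \<in> ball 0 R")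
      case True
      \<comment> \<open>The ball is open, so the image coordinates are strictly below
        \<open>M ^ n\<close> and their floors fit the half-open index range.\<close>
      have I: "\<lfloor>\<Phi> x $ l\<rfloor> \<in> ?I" for l
      proof -
        have "\<bar>\<Phi> x $ l\<bar> \<le> B * norm x" by (rule bound)
        also have "\<dots> < B * R" using True B by (intro mult_strict_left_mono) (auto simp: dist_norm)
        finally have "\<bar>\<Phi> x $ l\<bar> < real_of_int (int M ^ n)" using R by simp
        then show ?thesis by (simp add: le_floor_iff floor_less_iff abs_less_iff)
      qed
      let ?h = "\<lambda>i j k. ennreal (?g x) * indicator (Q i j k) x"
      have "ennreal (?g x) = ?h (\<lfloor>\<Phi> x $ 1\<rfloor>) (\<lfloor>\<Phi> x $ 2\<rfloor>) (\<lfloor>\<Phi> x $ 3\<rfloor>)" by (simp add: Q_def)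
      also have "\<dots> \<le> (\<Sum>k\<in>?I. ?h (\<lfloor>\<Phi> x $ 1\<rfloor>) (\<lfloor>\<Phi> x $ 2\<rfloor>) k)"
        by (rule member_le_sum[OF I]) auto
      also have "\<dots> \<le> (\<Sum>j\<in>?I. \<Sum>k\<in>?I. ?h (\<lfloor>\<Phi> x $ 1\<rfloor>) j k)"
        by (rule member_le_sum[OF I[of 2], of "\<lambda>j. \<Sum>k\<in>?I. ?h (\<lfloor>\<Phi> x $ 1\<rfloor>) j k"]) (auto simp: zero_le)
      also have "\<dots> \<le> (\<Sum>i\<in>?I. \<Sum>j\<in>?I. \<Sum>k\<in>?I. ?h i j k)"
        by (rule member_le_sum[OF I[of 1], of "\<lambda>i. \<Sum>j\<in>?I. \<Sum>k\<in>?I. ?h i j k"]) (auto simp: zero_le)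
      finally show ?thesis using True by simp
    qed (simp add: zero_le)
  qed
  also have "\<dots> = (\<Sum>i\<in>?I. \<Sum>j\<in>?I. \<Sum>k\<in>?I. (\<integral>\<^sup>+x\<in>Q i j k. ennreal (?g x) \<partial>lborel))"
  proof -
    have "(\<lambda>x. ennreal (?g x) * indicator (Q i j k) x) \<in> borel_measurable lborel" for i j k
      using gm Qm by simp
    then show ?thesis by (simp only: nn_integral_sum borel_measurable_sum)
  qed
  also have "\<dots> \<le> (\<Sum>i\<in>?I. \<Sum>j\<in>?I. \<Sum>k\<in>?I. ennreal (sqrt (a * b) *
      (sqrt (card (L1 i j k)) * sqrt (card (L2 i j k)) * sqrt (card (L3 i j k)))))"
    by (intro sum_mono cell)
  also have "\<dots> = ennreal (\<Sum>i\<in>?I. \<Sum>j\<in>?I. \<Sum>k\<in>?I. sqrt (a * b) *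
      (sqrt (card (L1 i j k)) * sqrt (card (L2 i j k)) * sqrt (card (L3 i j k))))"
    using ab by (simp add: sum_nonneg)
  also have "\<dots> = ennreal (sqrt (a * b) * (\<Sum>i\<in>?I. \<Sum>j\<in>?I. \<Sum>k\<in>?I. 
      sqrt (card (L1 i j k)) * sqrt (card (L2 i j k)) * sqrt (card (L3 i j k))))"
    by (simp add: sum_distrib_left)
  also have "\<dots> \<le> ennreal (sqrt (a * b) * (8 * ((8 * real c + 3) ^ 3) ^ n *
       (sqrt (real (card F1)) * sqrt (real (card F2)) * sqrt (real (card F3)))))"
    unfolding L1_def L2_def L3_def
    using ab by (intro ennreal_leI mult_left_mono discrete_kakeya M c fin steep) auto
  finally show ?thesis by (simp add: algebra_simps)
qed

section \<open>Coordinates adapted to a transversal triple\<close>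

lemma unit_tube_borel [measurable]: "unit_tube a v \<in> sets borel"
proof -
  have "closed (unit_tube a v)"
    unfolding unit_tube_def by (intro closed_Collect_le continuous_intros)
  then show ?thesis by (rule borel_closed)
qed

text \<open>Without normalisation the normal is affine in \<xi>: differences of normals are
  horizontal, and determinants of three normals become planar areas.\<close>

definition normal_vec :: "real^2 \<Rightarrow> real^3" where
  "normal_vec \<xi> = vector [- \<xi> $ 1, - \<xi> $ 2, 1]"

lemma normal_vec_nth [simp]:
  "normal_vec \<xi> $ 1 = - \<xi> $ 1" "normal_vec \<xi> $ 2 = - \<xi> $ 2" "normal_vec \<xi> $ 3 = 1"
  by (simp_all add: normal_vec_def)

lemma unit_normal_parab: "unit_normal (parab \<xi>) = sgn (normal_vec \<xi>)"
  by (simp add: unit_normal_def normal_vec_def parab_def)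

lemma norm_normal_vec_le: "norm \<xi> \<le> 2 \<Longrightarrow> norm (normal_vec \<xi>) \<le> 3"
proof -
  assume \<xi>: "norm \<xi> \<le> 2"
  have "(norm (normal_vec \<xi>))\<^sup>2 = (norm \<xi>)\<^sup>2 + 1"
    by (simp only: power2_norm_eq_inner inner_vec_def sum_2 sum_3 normal_vec_nth) simp
  also have "\<dots> \<le> 2\<^sup>2 + 1" using \<xi> by (intro add_right_mono power_mono) auto
  also have "\<dots> \<le> 3\<^sup>2" by simp
  finally show ?thesis by (rule power2_le_imp_le) simp
qed

lemma norm_vec2_le: "norm (x :: real^2) \<le> \<bar>x $ 1\<bar> + \<bar>x $ 2\<bar>"
  using norm_le_l1_cart[of x] by (simp add: sum_2)

lemma norm_vec3_le: "norm (x :: real^3) \<le> \<bar>x $ 1\<bar> + \<bar>x $ 2\<bar> + \<bar>x $ 3\<bar>"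
  using norm_le_l1_cart[of x] by (simp add: sum_3)

text \<open>Relaxing the radius from 1 to 2 yields an axis point straight from the definition of the
  infimum. The parameter is divided by the length of the normal because the axis is now traversed by
  \<open>normal_vec\<close>.\<close>

lemma unit_tube_near_axis:
  assumes "x \<in> unit_tube a (unit_normal (parab \<xi>))"
  shows "\<exists>s. norm (x - (a + s *\<^sub>R normal_vec \<xi>)) \<le> 2"
proof -
  let ?A = "range (\<lambda>s. a + s *\<^sub>R unit_normal (parab \<xi>))"
  have "infdist x ?A < 2" using assms by (simp add: unit_tube_def)
  then obtain y where "y \<in> ?A" "dist x y < 2"
    using cInf_lessD[of "dist x ` ?A" 2] by (auto simp: infdist_notempty)
  then obtain s where "dist x (a + s *\<^sub>R unit_normal (parab \<xi>)) < 2" by blast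
  then show ?thesis
    by (intro exI[of _ "s / norm (normal_vec \<xi>)"])
      (simp add: unit_normal_parab sgn_div_norm dist_norm divide_inverse)
qed

section \<open>Planar boxes, wedges and cross products\<close>

definition perp :: "real^2 \<Rightarrow> real^2" where
  "perp w = vector [- w $ 2, w $ 1]"

definition in_box :: "real^2 \<Rightarrow> real \<Rightarrow> real \<Rightarrow> real^2 \<Rightarrow> bool" where
  "in_box w a b x \<longleftrightarrow> \<bar>x \<bullet> w\<bar> \<le> a \<and> \<bar>x \<bullet> perp w\<bar> \<le> b"

lemma inner_vec2: "(x :: real^2) \<bullet> y = x $ 1 * y $ 1 + x $ 2 * y $ 2"
  by (simp add: inner_vec_def sum_2)

lemma unit_vec2: "norm (w :: real^2) = 1 \<Longrightarrow> w $ 1 * w $ 1 + w $ 2 * w $ 2 = 1"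
  by (simp add: norm_eq_1 inner_vec2)

lemma frame_decomp:
  assumes "norm w = 1"
  shows "x = (x \<bullet> w) *\<^sub>R w + (x \<bullet> perp w) *\<^sub>R perp w"
proof -
  have "x $ 1 = (x $ 1 * w $ 1 + x $ 2 * w $ 2) * w $ 1 + (x $ 1 * - w $ 2 + x $ 2 * w $ 1) * - w $ 2"
    "x $ 2 = (x $ 1 * w $ 1 + x $ 2 * w $ 2) * w $ 2 + (x $ 1 * - w $ 2 + x $ 2 * w $ 1) * w $ 1"
    using unit_vec2[OF assms] by algebra+
  then show ?thesis by (simp add: vec_eq_iff forall_2 inner_vec2 perp_def)
qed

lemma norm_perp [simp]: "norm (perp w) = norm w"
  by (simp add: norm_eq_sqrt_inner inner_vec2 perp_def)

lemma in_box_norm_le: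
  assumes "norm w = 1" "in_box w a b x"
  shows "norm x \<le> a + b"
proof -
  have "norm x \<le> norm ((x \<bullet> w) *\<^sub>R w) + norm ((x \<bullet> perp w) *\<^sub>R perp w)"
    by (subst frame_decomp[OF assms(1), of x]) (rule norm_triangle_ineq)
  also have "\<dots> \<le> a + b" using assms by (simp add: in_box_def)
  finally show ?thesis .
qed

lemma in_box_diff:
  assumes "in_box w a b x" "in_box w a' b' y"
  shows "in_box w (a + a') (b + b') (x - y)"
  using assms unfolding in_box_def inner_diff_left by linarith

lemma in_box_mono: "in_box w a b x \<Longrightarrow> a \<le> a' \<Longrightarrow> b \<le> b' \<Longrightarrow> in_box w a' b' x"
  unfolding in_box_def by linarith

text \<open>The wedge is the same in the orthonormal frame of \<open>w\<close> and
  \<open>perp w\<close>, where each of its two products pairs a long side of one box with a short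
  side of the other.\<close>

lemma wedge_le:
  assumes w: "norm w = 1" and x: "in_box w a (a * \<tau>) x" and y: "in_box w b (b * \<tau>) y"
    and pos: "0 \<le> a" "0 \<le> b" "0 \<le> \<tau>"
  shows "\<bar>x $ 1 * y $ 2 - x $ 2 * y $ 1\<bar> \<le> 2 * a * b * \<tau>"
proof -
  have "x $ 1 * y $ 2 - x $ 2 * y $ 1 = (x \<bullet> w) * (y \<bullet> perp w) - (x \<bullet> perp w) * (y \<bullet> w)"
    using unit_vec2[OF w] unfolding inner_vec2 perp_def vector_2 by algebra
  then have "\<bar>x $ 1 * y $ 2 - x $ 2 * y $ 1\<bar> \<le> \<bar>x \<bullet> w\<bar> * \<bar>y \<bullet> perp w\<bar> + \<bar>x \<bullet> perp w\<bar> * \<bar>y \<bullet> w\<bar>"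
    by (simp add: abs_mult[symmetric] abs_triangle_ineq4)
  also have "\<dots> \<le> a * (b * \<tau>) + (a * \<tau>) * b"
    using x y pos by (intro add_mono mult_mono) (auto simp: in_box_def)
  finally show ?thesis by (simp add: algebra_simps)
qed

text \<open>The cross product of \<open>normal_vec p\<close> and \<open>normal_vec q\<close>.\<close>

definition normal_cross :: "real^2 \<Rightarrow> real^2 \<Rightarrow> real^3" where
  "normal_cross p q = vector [q $ 2 - p $ 2, p $ 1 - q $ 1, p $ 1 * q $ 2 - p $ 2 * q $ 1]"

lemma inner_vec3: "(x :: real^3) \<bullet> y = x $ 1 * y $ 1 + x $ 2 * y $ 2 + x $ 3 * y $ 3"
  by (simp add: inner_vec_def sum_3)

lemma normal_cross_inner [simp]:
  "normal_cross p q \<bullet> normal_vec p = 0" "normal_cross p q \<bullet> normal_vec q = 0"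
  by (simp_all add: normal_cross_def inner_vec3 algebra_simps)

text \<open>Cyclic invariance of the triple product: the three functionals dual to a basis of
  normals share one denominator.\<close>

lemma normal_cross_cyclic:
  "normal_cross q s \<bullet> normal_vec p = normal_cross p q \<bullet> normal_vec s"
  "normal_cross s p \<bullet> normal_vec q = normal_cross p q \<bullet> normal_vec s"
  by (simp_all add: normal_cross_def inner_vec3 algebra_simps)

lemma normal_cross_det:
  assumes "det (\<chi> n::3. normal_vec (\<xi> n)) = d"
  shows "normal_cross (\<xi> 1) (\<xi> 2) \<bullet> normal_vec (\<xi> 3) = d"
  using assms by (simp add: det_3 normal_cross_def inner_vec3 algebra_simps)

text \<open>The third component of the cross product drops out because differences of normals are
  horizontal. What remains is a planar wedge of displacements, which gains the width factor
  \<tau>.\<close>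

lemma normal_cross_inner_diff:
  "normal_cross p q \<bullet> (normal_vec x - normal_vec y)
    = (x - y) $ 1 * (p - q) $ 2 - (x - y) $ 2 * (p - q) $ 1"
  by (simp add: normal_cross_def inner_vec3 algebra_simps)

text \<open>The third component also vanishes for \<open>p = q\<close>: rewritten through
  \<open>p - q\<close> it is at most \<open>4 * norm (p - q)\<close>, and the first two components
  contribute one each.\<close>

lemma norm_normal_cross_le:
  assumes "norm p \<le> 2"
  shows "norm (normal_cross p q) \<le> 6 * norm (p - q)"
proof -
  have pq: "\<bar>(p - q) $ 1\<bar> \<le> norm (p - q)" "\<bar>(p - q) $ 2\<bar> \<le> norm (p - q)"
    by (rule component_le_norm_cart)+
  have p: "\<bar>p $ 1\<bar> \<le> 2" "\<bar>p $ 2\<bar> \<le> 2"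
    using component_le_norm_cart[of p] assms order.trans by blast+
  have "p $ 1 * q $ 2 - p $ 2 * q $ 1 = p $ 2 * (p - q) $ 1 - p $ 1 * (p - q) $ 2"
    by (simp add: algebra_simps)
  then have "\<bar>p $ 1 * q $ 2 - p $ 2 * q $ 1\<bar> \<le> \<bar>p $ 2\<bar> * \<bar>(p - q) $ 1\<bar> + \<bar>p $ 1\<bar> * \<bar>(p - q) $ 2\<bar>"
    by (simp only: abs_mult[symmetric] abs_triangle_ineq4)
  also have "\<dots> \<le> 2 * norm (p - q) + 2 * norm (p - q)"
    using pq p by (intro add_mono mult_mono) auto
  finally have 3: "\<bar>p $ 1 * q $ 2 - p $ 2 * q $ 1\<bar> \<le> 4 * norm (p - q)" by simp
  have "norm (normal_cross p q) \<le> \<bar>q $ 2 - p $ 2\<bar> + \<bar>p $ 1 - q $ 1\<bar> + \<bar>p $ 1 * q $ 2 - p $ 2 * q $ 1\<bar>"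
    using norm_vec3_le[of "normal_cross p q"] by (simp add: normal_cross_def)
  then show ?thesis using 3 pq by (simp add: abs_minus_commute)
qed

section \<open>Volumes of intersections of tubes and of tubes with slabs\<close>

text \<open>Two common points of the tubes give displacements along both axes that agree up to 8.
  Comparing third coordinates, the parameter differences agree up to 8 as well; comparing the
  horizontal parts, the separation of directions limits the first one to
  \<open>(8 + 8 * 2) / \<delta>\<close>.\<close>

lemma emeasure_tube_inter_le:
  assumes \<xi>: "norm \<xi> \<le> 2" "norm \<xi>' \<le> 2" and sep: "\<delta> \<le> norm (\<xi> - \<xi>')" "0 < \<delta>"
  shows "emeasure lborel (unit_tube a (unit_normal (parab \<xi>)) \<inter> unit_tube a' (unit_normal (parab \<xi>')))
    \<le> ennreal (5000 * (24 / \<delta> + 1))"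
proof (rule emeasure_tube_segment_le[OF norm_normal_vec_le[OF \<xi>(1)]])
  show "0 \<le> 24 / \<delta>" using sep by simp
  fix x assume "x \<in> unit_tube a (unit_normal (parab \<xi>)) \<inter> unit_tube a' (unit_normal (parab \<xi>'))"
  then show "\<exists>s. norm (x - (a + s *\<^sub>R normal_vec \<xi>)) \<le> 2" using unit_tube_near_axis by blast
next
  fix x y s1 s2
  assume xy: "x \<in> unit_tube a (unit_normal (parab \<xi>)) \<inter> unit_tube a' (unit_normal (parab \<xi>'))"
    "y \<in> unit_tube a (unit_normal (parab \<xi>)) \<inter> unit_tube a' (unit_normal (parab \<xi>'))"
    and s: "norm (x - (a + s1 *\<^sub>R normal_vec \<xi>)) \<le> 2" "norm (y - (a + s2 *\<^sub>R normal_vec \<xi>)) \<le> 2"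
  from xy obtain t1 t2 where t: "norm (x - (a' + t1 *\<^sub>R normal_vec \<xi>')) \<le> 2"
      "norm (y - (a' + t2 *\<^sub>R normal_vec \<xi>')) \<le> 2"
    using unit_tube_near_axis by (meson IntD2)
  define e where "e = s1 - s2"
  define f where "f = t1 - t2"
  define d where "d = e *\<^sub>R normal_vec \<xi> - f *\<^sub>R normal_vec \<xi>'"
  have "d = ((y - (a + s2 *\<^sub>R normal_vec \<xi>)) - (x - (a + s1 *\<^sub>R normal_vec \<xi>)))
     + ((x - (a' + t1 *\<^sub>R normal_vec \<xi>')) - (y - (a' + t2 *\<^sub>R normal_vec \<xi>')))"
    by (simp add: d_def e_def f_def algebra_simps)
  also have "norm \<dots> \<le> (2 + 2) + (2 + 2)"
    by (rule norm_triangle_mono; rule norm_triangle_le_diff; use s t in linarith)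
  finally have d: "norm d \<le> 8" by simp
  have d': "\<bar>d $ k\<bar> \<le> 8" for k using component_le_norm_cart[of d k] d by linarith
  have ef: "\<bar>e - f\<bar> \<le> 8" using d'[of 3] by (simp add: d_def)
  have "norm (e *\<^sub>R (\<xi> - \<xi>')) \<le> norm (e *\<^sub>R \<xi> - f *\<^sub>R \<xi>') + norm ((e - f) *\<^sub>R \<xi>')"
  proof -
    have "e *\<^sub>R (\<xi> - \<xi>') = (e *\<^sub>R \<xi> - f *\<^sub>R \<xi>') - (e - f) *\<^sub>R \<xi>'" by (simp add: algebra_simps)
    then show ?thesis by (simp only: norm_triangle_ineq4)
  qed
  also have "norm (e *\<^sub>R \<xi> - f *\<^sub>R \<xi>') \<le> norm d"
  proof -
    have "d $ 1 = - ((e *\<^sub>R \<xi> - f *\<^sub>R \<xi>') $ 1)" "d $ 2 = - ((e *\<^sub>R \<xi> - f *\<^sub>R \<xi>') $ 2)"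
      by (simp_all add: d_def)
    then have "(norm (e *\<^sub>R \<xi> - f *\<^sub>R \<xi>'))\<^sup>2 \<le> (norm d)\<^sup>2"
      by (simp only: power2_norm_eq_inner inner_vec2 inner_vec3 minus_mult_minus) simp
    then show ?thesis by (rule power2_le_imp_le) simp
  qed
  also have "norm ((e - f) *\<^sub>R \<xi>') \<le> 8 * 2"
    unfolding norm_scaleR using ef \<xi> by (intro mult_mono) auto
  finally have "\<bar>e\<bar> * norm (\<xi> - \<xi>') \<le> 24" using d by simp
  moreover have "\<bar>e\<bar> * \<delta> \<le> \<bar>e\<bar> * norm (\<xi> - \<xi>')" using sep by (intro mult_left_mono) auto
  ultimately show "\<bar>s1 - s2\<bar> \<le> 24 / \<delta>" using sep by (simp add: e_def field_simps)
qed

text \<open>Along the axis \<open>\<phi>\<close> varies at rate at least \<delta>. Inside the slab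
  it changes by at most 1, and the width of the tube accounts for \<open>4 * B\<close> more, so the
  parameters spread over at most \<open>(1 + 4 * B) / \<delta>\<close>.\<close>

lemma emeasure_tube_slab_le:
  fixes \<phi> :: "real^3 \<Rightarrow> real"
  assumes lin: "linear \<phi>" and bound: "\<And>x. \<bar>\<phi> x\<bar> \<le> B * norm x" and B: "0 \<le> B"
    and \<xi>: "norm \<xi> \<le> 2" and fast: "\<delta> \<le> \<bar>\<phi> (normal_vec \<xi>)\<bar>" "0 < \<delta>"
  shows "emeasure lborel {x \<in> unit_tube a (unit_normal (parab \<xi>)). \<lfloor>\<phi> x\<rfloor> = z}
    \<le> ennreal (5000 * ((1 + 4 * B) / \<delta> + 1))"
proof (rule emeasure_tube_segment_le[OF norm_normal_vec_le[OF \<xi>]])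
  show "0 \<le> (1 + 4 * B) / \<delta>" using B fast by simp
  fix x assume "x \<in> {x \<in> unit_tube a (unit_normal (parab \<xi>)). \<lfloor>\<phi> x\<rfloor> = z}"
  then show "\<exists>s. norm (x - (a + s *\<^sub>R normal_vec \<xi>)) \<le> 2" using unit_tube_near_axis by blast
next
  fix x y s1 s2
  assume xy: "x \<in> {x \<in> unit_tube a (unit_normal (parab \<xi>)). \<lfloor>\<phi> x\<rfloor> = z}"
    "y \<in> {x \<in> unit_tube a (unit_normal (parab \<xi>)). \<lfloor>\<phi> x\<rfloor> = z}"
    and s: "norm (x - (a + s1 *\<^sub>R normal_vec \<xi>)) \<le> 2" "norm (y - (a + s2 *\<^sub>R normal_vec \<xi>)) \<le> 2"
  define d where "d = (y - (a + s2 *\<^sub>R normal_vec \<xi>)) - (x - (a + s1 *\<^sub>R normal_vec \<xi>))"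
  have "norm d \<le> 4" unfolding d_def by (rule norm_triangle_le_diff) (use s in linarith)
  have "\<bar>\<phi> d\<bar> \<le> B * norm d" by (rule bound)
  also have "\<dots> \<le> B * 4" using \<open>norm d \<le> 4\<close> B by (intro mult_left_mono)
  finally have 1: "\<bar>\<phi> d\<bar> \<le> 4 * B" by simp
  have "d = (s1 - s2) *\<^sub>R normal_vec \<xi> - (x - y)" by (simp add: d_def algebra_simps)
  then have "\<phi> d = (s1 - s2) * \<phi> (normal_vec \<xi>) - (\<phi> x - \<phi> y)"
    using lin by (simp add: linear_diff linear_scale)
  moreover have "\<bar>\<phi> x - \<phi> y\<bar> \<le> 1" using xy by (simp add: floor_eq_iff abs_le_iff)
  ultimately have "\<bar>s1 - s2\<bar> * \<bar>\<phi> (normal_vec \<xi>)\<bar> \<le> 1 + 4 * B" using 1 unfolding abs_mult[symmetric] by linarith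
  moreover have "\<bar>s1 - s2\<bar> * \<delta> \<le> \<bar>s1 - s2\<bar> * \<bar>\<phi> (normal_vec \<xi>)\<bar>"
    using fast by (intro mult_left_mono) auto
  ultimately show "\<bar>s1 - s2\<bar> \<le> (1 + 4 * B) / \<delta>" using fast by (simp add: field_simps)
qed

section \<open>The linear change of coordinates for a triple of pieces\<close>

text \<open>The components of \<open>\<Phi>\<close> are the dual basis of the normals at the base
  points, scaled. A dual functional has size about the opposite side of the triangle divided by
  \<open>D\<close>; that side is about \<rho> for the weight \<open>\<tau> * \<kappa>\<close> and
  about \<kappa> for the weight \<open>\<tau> * \<rho>\<close>. Both products are
  \<open>\<kappa> * \<rho> * \<tau>\<close>, comparable to the lower bound for \<open>D\<close>,
  hence \<open>\<Phi>\<close> is bounded. Displacements within a piece gain one more \<tau> from the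
  wedge, so they are small against the base vectors.\<close>

lemma steep_coordinates:
  fixes \<Phi> :: "real^3 \<Rightarrow> real^3"
  assumes w: "norm w = 1" and pos: "0 < \<kappa>" "\<kappa> \<le> \<rho>" "0 < \<tau>" "\<tau> \<le> 1" "0 < K" "0 < B" "0 < \<eta>"
    and \<beta>: "norm \<beta>1 \<le> 2" "norm \<beta>2 \<le> 2" "norm \<beta>3 \<le> 2"
    and box: "in_box w (B * \<kappa>) (B * \<kappa> * \<tau>) (\<beta>1 - m)" "in_box w (B * \<kappa>) (B * \<kappa> * \<tau>) (\<beta>2 - m)"
      "in_box w (B * \<rho>) (B * \<rho> * \<tau>) (\<beta>3 - m)"
    and D: "D = normal_cross \<beta>1 \<beta>2 \<bullet> normal_vec \<beta>3" "\<kappa> * \<rho> * \<tau> / K \<le> \<bar>D\<bar>"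
    and \<eta>: "4 * B * K * \<eta> * (real M + 1) \<le> 1" and M: "1 \<le> M"
    and \<Phi>_def: "\<Phi> = (\<lambda>x. vector [\<tau> * \<kappa> / D * (normal_cross \<beta>2 \<beta>3 \<bullet> x),
      \<tau> * \<kappa> / D * (normal_cross \<beta>3 \<beta>1 \<bullet> x), \<tau> * \<rho> / D * (normal_cross \<beta>1 \<beta>2 \<bullet> x)])"
  shows "linear \<Phi>" "\<bar>\<Phi> x $ k\<bar> \<le> 24 * B * K * norm x"
    "in_box w (\<eta> * \<kappa>) (\<eta> * \<kappa> * \<tau>) (\<xi> - \<beta>1) \<Longrightarrow> steep M 1 (\<Phi> (normal_vec \<xi>))"
    "in_box w (\<eta> * \<kappa>) (\<eta> * \<kappa> * \<tau>) (\<xi> - \<beta>2) \<Longrightarrow> steep M 2 (\<Phi> (normal_vec \<xi>))"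
    "in_box w (\<eta> * \<rho>) (\<eta> * \<rho> * \<tau>) (\<xi> - \<beta>3) \<Longrightarrow> steep M 3 (\<Phi> (normal_vec \<xi>))"
    "in_box w (\<eta> * \<rho>) (\<eta> * \<rho> * \<tau>) (\<xi> - \<beta>3) \<Longrightarrow> \<tau> * \<rho> / 2 \<le> \<bar>\<Phi> (normal_vec \<xi>) $ 3\<bar>"
proof -
  have \<rho>: "0 < \<rho>" using pos by simp
  have "0 < \<kappa> * \<rho> * \<tau> / K" using pos \<rho> by simp
  then have D0: "0 < \<bar>D\<bar>" "D \<noteq> 0" using D(2) by linarith+
  have lin: "linear \<Phi>"
    unfolding \<Phi>_def by (intro linearI) (simp_all add: vec_eq_iff forall_3 inner_add_right inner_scaleR_right distrib_left)
  show "linear \<Phi>" by (rule lin)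
  have d12: "in_box w (2 * B * \<kappa>) (2 * B * \<kappa> * \<tau>) (\<beta>1 - \<beta>2)"
    using in_box_diff[OF box(1,2)] by (simp add: mult.assoc)
  have \<kappa>\<rho>: "B * \<kappa> + B * \<rho> \<le> 2 * B * \<rho>" "B * \<kappa> * \<tau> + B * \<rho> * \<tau> \<le> 2 * B * \<rho> * \<tau>"
  proof -
    have "B * \<kappa> \<le> B * \<rho>" using pos by (intro mult_left_mono) auto
    moreover from this have "B * \<kappa> * \<tau> \<le> B * \<rho> * \<tau>" using pos by (intro mult_right_mono) auto
    ultimately show "B * \<kappa> + B * \<rho> \<le> 2 * B * \<rho>" "B * \<kappa> * \<tau> + B * \<rho> * \<tau> \<le> 2 * B * \<rho> * \<tau>"
      by linarith+
  qed
  have d23: "in_box w (2 * B * \<rho>) (2 * B * \<rho> * \<tau>) (\<beta>2 - \<beta>3)"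
    using in_box_mono[OF in_box_diff[OF box(2,3)] \<kappa>\<rho>] by simp
  have d31: "in_box w (2 * B * \<rho>) (2 * B * \<rho> * \<tau>) (\<beta>3 - \<beta>1)"
    using in_box_mono[OF in_box_diff[OF box(3,1)]] \<kappa>\<rho> by (simp add: add.commute)
  \<comment> \<open>Here \<open>\<alpha>\<close> is the weight of a functional without \<tau>, and
    \<open>\<mu>\<close> is the size of the opposite side; their product is always
    \<open>\<kappa> * \<rho>\<close>.\<close>
  have coef: "\<tau> * \<alpha> / \<bar>D\<bar> * (c * \<mu>) \<le> c * K" if "\<alpha> * \<mu> = \<kappa> * \<rho>" "0 \<le> c" for \<alpha> \<mu> c
  proof -
    have "\<tau> * \<alpha> * \<mu> = \<kappa> * \<rho> * \<tau>" using that by (simp add: algebra_simps)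
    also have "\<dots> \<le> K * \<bar>D\<bar>" using D(2) pos by (simp add: field_simps)
    finally have "c * (\<tau> * \<alpha> * \<mu>) \<le> c * (K * \<bar>D\<bar>)" using that by (intro mult_left_mono)
    then show ?thesis using D0 by (simp add: field_simps)
  qed
  have coord_le: "\<bar>\<tau> * \<alpha> / D * (normal_cross p q \<bullet> y)\<bar> \<le> 24 * B * K * norm y"
    if "norm p \<le> 2" "in_box w (2 * B * \<mu>) (2 * B * \<mu> * \<tau>) (p - q)" "\<alpha> * \<mu> = \<kappa> * \<rho>" "0 < \<alpha>" "0 < \<mu>" for p q y \<alpha> \<mu>
  proof -
    have "norm (p - q) \<le> 2 * B * \<mu> + 2 * B * \<mu> * \<tau>" by (rule in_box_norm_le[OF w that(2)])
    also have "\<dots> \<le> 2 * B * \<mu> + 2 * B * \<mu> * 1" using pos that by (intro add_left_mono mult_left_mono) auto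
    finally have "6 * norm (p - q) \<le> 24 * B * \<mu>" by simp
    then have "norm (normal_cross p q) \<le> 24 * B * \<mu>" using norm_normal_cross_le[OF that(1), of q] by linarith
    then have "\<bar>normal_cross p q \<bullet> y\<bar> \<le> 24 * B * \<mu> * norm y"
      using Cauchy_Schwarz_ineq2[of "normal_cross p q" y] by (meson mult_right_mono norm_ge_zero order.trans)
    then have "\<bar>\<tau> * \<alpha> / D * (normal_cross p q \<bullet> y)\<bar> \<le> \<tau> * \<alpha> / \<bar>D\<bar> * (24 * B * \<mu> * norm y)"
      using pos that by (simp add: abs_mult mult_left_mono divide_right_mono)
    also have "\<dots> = \<tau> * \<alpha> / \<bar>D\<bar> * ((24 * B * norm y) * \<mu>)" by simp
    also have "\<dots> \<le> (24 * B * norm y) * K" using pos by (intro coef that) auto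
    finally show ?thesis by (simp add: mult_ac)
  qed
  have \<Phi>_nth: "\<Phi> y $ 1 = \<tau> * \<kappa> / D * (normal_cross \<beta>2 \<beta>3 \<bullet> y)"
    "\<Phi> y $ 2 = \<tau> * \<kappa> / D * (normal_cross \<beta>3 \<beta>1 \<bullet> y)"
    "\<Phi> y $ 3 = \<tau> * \<rho> / D * (normal_cross \<beta>1 \<beta>2 \<bullet> y)" for y
    by (simp_all add: \<Phi>_def)
  have "\<forall>k. \<bar>\<Phi> x $ k\<bar> \<le> 24 * B * K * norm x"
    unfolding forall_3 \<Phi>_nth
    using coord_le[OF \<beta>(2) d23, of \<kappa>] coord_le[OF \<beta>(3) d31, of \<kappa>] coord_le[OF \<beta>(1) d12, of \<rho>] pos \<rho>
    by (simp add: mult.commute)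
  then show "\<bar>\<Phi> x $ k\<bar> \<le> 24 * B * K * norm x" by blast
  \<comment> \<open>The relative deviation of a direction in a piece from its base direction. The
    smallness of \<eta> says \<open>e * (M + 1) \<le> 1\<close>, that is, \<open>e * M\<close> is at
    most the part \<open>1 - e\<close> that surely survives on the main axis.\<close>
  define e where "e = 4 * B * K * \<eta>"
  have e: "0 \<le> e" "e * real M \<le> 1 - e" "e \<le> 1 / 2"
  proof -
    show "0 \<le> e" using pos by (simp add: e_def)
    show "e * real M \<le> 1 - e" using \<eta> by (simp add: e_def algebra_simps)
    moreover have "e * 1 \<le> e * real M" using \<open>0 \<le> e\<close> M by (intro mult_left_mono) auto
    ultimately show "e \<le> 1 / 2" by simp
  qed
  have coord_diff: "\<bar>\<tau> * \<alpha> / D * (normal_cross p q \<bullet> (normal_vec \<xi> - normal_vec \<beta>))\<bar> \<le> e * (\<nu> * \<tau>)"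
    if "in_box w (2 * B * \<mu>) (2 * B * \<mu> * \<tau>) (p - q)" "\<alpha> * \<mu> = \<kappa> * \<rho>" "0 < \<alpha>" "0 < \<mu>"
       "in_box w (\<eta> * \<nu>) (\<eta> * \<nu> * \<tau>) (\<xi> - \<beta>)" "0 < \<nu>" for p q \<alpha> \<mu> \<nu> \<xi> \<beta>
  proof -
    have "\<bar>normal_cross p q \<bullet> (normal_vec \<xi> - normal_vec \<beta>)\<bar> \<le> 2 * (\<eta> * \<nu>) * (2 * B * \<mu>) * \<tau>"
      unfolding normal_cross_inner_diff using pos that by (intro wedge_le[OF w that(5,1)]) auto
    then have "\<bar>\<tau> * \<alpha> / D * (normal_cross p q \<bullet> (normal_vec \<xi> - normal_vec \<beta>))\<bar>
       \<le> \<tau> * \<alpha> / \<bar>D\<bar> * (2 * (\<eta> * \<nu>) * (2 * B * \<mu>) * \<tau>)"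
      using pos that by (simp add: abs_mult mult_left_mono divide_right_mono)
    also have "\<dots> = \<tau> * \<alpha> / \<bar>D\<bar> * ((4 * B * \<eta> * \<nu> * \<tau>) * \<mu>)" by simp
    also have "\<dots> \<le> (4 * B * \<eta> * \<nu> * \<tau>) * K" using pos that by (intro coef that) auto
    finally show ?thesis by (simp add: e_def mult_ac)
  qed
  have coords: "\<forall>k. \<bar>\<Phi> (normal_vec \<xi>) $ k - \<Phi> (normal_vec \<beta>) $ k\<bar> \<le> e * (\<nu> * \<tau>)"
    if "in_box w (\<eta> * \<nu>) (\<eta> * \<nu> * \<tau>) (\<xi> - \<beta>)" "0 < \<nu>" for \<nu> \<xi> \<beta>
    unfolding forall_3 \<Phi>_nth right_diff_distrib[symmetric] inner_diff_right[symmetric]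
    using coord_diff[OF d23 _ _ _ that, of \<kappa>] coord_diff[OF d31 _ _ _ that, of \<kappa>] coord_diff[OF d12 _ _ _ that, of \<rho>] pos \<rho>
    by (simp add: mult.commute)
  \<comment> \<open>Off-diagonal entries vanish by orthogonality of the cross product, and cyclicity
    cancels \<open>D\<close> on the diagonal.\<close>
  have base: "\<Phi> (normal_vec \<beta>1) = axis 1 (\<kappa> * \<tau>)" "\<Phi> (normal_vec \<beta>2) = axis 2 (\<kappa> * \<tau>)"
     "\<Phi> (normal_vec \<beta>3) = axis 3 (\<rho> * \<tau>)"
    using D0 normal_cross_cyclic(1)[of \<beta>2 \<beta>3 \<beta>1] normal_cross_cyclic(2)[of \<beta>3 \<beta>1 \<beta>2]
    unfolding vec_eq_iff forall_3 \<Phi>_nth D(1)[symmetric] by (simp_all add: axis_def)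
  have steepI: "steep M i (\<Phi> (normal_vec \<xi>))" "\<nu> * \<tau> / 2 \<le> \<bar>\<Phi> (normal_vec \<xi>) $ i\<bar>"
    if "in_box w (\<eta> * \<nu>) (\<eta> * \<nu> * \<tau>) (\<xi> - \<beta>)" "0 < \<nu>" "\<Phi> (normal_vec \<beta>) = axis i (\<nu> * \<tau>)" for \<nu> \<xi> \<beta> i
  proof -
    have \<nu>: "0 < \<nu> * \<tau>" using that pos by simp
    have k: "\<bar>\<Phi> (normal_vec \<xi>) $ k - axis i (\<nu> * \<tau>) $ k\<bar> \<le> e * (\<nu> * \<tau>)" for k
      using coords[OF that(1,2)] that(3) by simp
    have i: "(1 - e) * (\<nu> * \<tau>) \<le> \<bar>\<Phi> (normal_vec \<xi>) $ i\<bar>"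
      using k[of i] by (simp add: axis_def algebra_simps)
    show "steep M i (\<Phi> (normal_vec \<xi>))"
      unfolding steep_def
    proof (intro allI impI)
      fix l assume "l \<noteq> i"
      then have "real M * \<bar>\<Phi> (normal_vec \<xi>) $ l\<bar> \<le> real M * (e * (\<nu> * \<tau>))"
        using k[of l] by (intro mult_left_mono) (auto simp: axis_def)
      also have "\<dots> = (e * real M) * (\<nu> * \<tau>)" by simp
      also have "\<dots> \<le> (1 - e) * (\<nu> * \<tau>)" using e \<nu> by (intro mult_right_mono) auto
      finally show "real M * \<bar>\<Phi> (normal_vec \<xi>) $ l\<bar> \<le> \<bar>\<Phi> (normal_vec \<xi>) $ i\<bar>" using i by linarith
    qed
    have "1 / 2 * (\<nu> * \<tau>) \<le> (1 - e) * (\<nu> * \<tau>)" using e \<nu> by (intro mult_right_mono) auto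
    then show "\<nu> * \<tau> / 2 \<le> \<bar>\<Phi> (normal_vec \<xi>) $ i\<bar>" using i by simp
  qed
  show "in_box w (\<eta> * \<kappa>) (\<eta> * \<kappa> * \<tau>) (\<xi> - \<beta>1) \<Longrightarrow> steep M 1 (\<Phi> (normal_vec \<xi>))"
    "in_box w (\<eta> * \<kappa>) (\<eta> * \<kappa> * \<tau>) (\<xi> - \<beta>2) \<Longrightarrow> steep M 2 (\<Phi> (normal_vec \<xi>))"
    "in_box w (\<eta> * \<rho>) (\<eta> * \<rho> * \<tau>) (\<xi> - \<beta>3) \<Longrightarrow> steep M 3 (\<Phi> (normal_vec \<xi>))"
    "in_box w (\<eta> * \<rho>) (\<eta> * \<rho> * \<tau>) (\<xi> - \<beta>3) \<Longrightarrow> \<tau> * \<rho> / 2 \<le> \<bar>\<Phi> (normal_vec \<xi>) $ 3\<bar>"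
    using steepI base pos(1) \<rho> by (simp_all add: mult.commute[of \<tau>])
qed

definition tubes_over :: "(real^2) set \<Rightarrow> (real^3) set set \<Rightarrow> bool" where
  "tubes_over A F \<longleftrightarrow> finite F \<and> (\<forall>T\<in>F. \<exists>\<xi>\<in>A. \<exists>a. T = unit_tube a (unit_normal (parab \<xi>)))"

lemma tubes_over_choose:
  assumes "tubes_over A F"
  obtains \<xi> a where "\<And>T. T \<in> F \<Longrightarrow> \<xi> T \<in> A" "\<And>T. T \<in> F \<Longrightarrow> T = unit_tube (a T) (unit_normal (parab (\<xi> T)))"
  using assms unfolding tubes_over_def by metis

text \<open>Arbitrary points of the three pieces serve as base points. Separation of the first two
  families gives \<open>a\<close> of order \<open>1 / \<kappa>\<close>, the third coordinate gives
  \<open>b\<close> of order \<open>1 / (\<tau> * \<rho>)\<close>, and their product is the expected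
  loss before taking the root.\<close>

lemma piece_bound:
  fixes F1 F2 F3 :: "(real^3) set set"
  assumes w: "norm w = 1" and pos: "0 < \<kappa>" "\<kappa> \<le> \<rho>" "\<rho> \<le> 1" "0 < \<tau>" "\<tau> \<le> 1" "1 \<le> K" "0 < B" "0 < \<eta>"
    and \<eta>: "4 * B * K * \<eta> * (real M + 1) \<le> 1" and M: "2 \<le> M" and c: "2 \<le> c" "1 + 48 * B * K \<le> real c"
    and small: "\<And>\<xi>. \<xi> \<in> P1 \<union> P2 \<union> P3 \<Longrightarrow> norm \<xi> \<le> 2"
    and box: "\<And>\<xi>. \<xi> \<in> P1 \<union> P2 \<Longrightarrow> in_box w (B * \<kappa>) (B * \<kappa> * \<tau>) (\<xi> - m)"
      "\<And>\<xi>. \<xi> \<in> P3 \<Longrightarrow> in_box w (B * \<rho>) (B * \<rho> * \<tau>) (\<xi> - m)"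
    and close: "\<And>\<xi> \<xi>'. \<xi> \<in> P1 \<Longrightarrow> \<xi>' \<in> P1 \<Longrightarrow> in_box w (\<eta> * \<kappa>) (\<eta> * \<kappa> * \<tau>) (\<xi> - \<xi>')"
      "\<And>\<xi> \<xi>'. \<xi> \<in> P2 \<Longrightarrow> \<xi>' \<in> P2 \<Longrightarrow> in_box w (\<eta> * \<kappa>) (\<eta> * \<kappa> * \<tau>) (\<xi> - \<xi>')"
      "\<And>\<xi> \<xi>'. \<xi> \<in> P3 \<Longrightarrow> \<xi>' \<in> P3 \<Longrightarrow> in_box w (\<eta> * \<rho>) (\<eta> * \<rho> * \<tau>) (\<xi> - \<xi>')"
    and sep: "\<And>\<xi> \<xi>'. \<xi> \<in> P1 \<Longrightarrow> \<xi>' \<in> P2 \<Longrightarrow> \<kappa> / K \<le> norm (\<xi> - \<xi>')"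
    and det: "\<And>\<xi> \<xi>' \<xi>''. \<xi> \<in> P1 \<Longrightarrow> \<xi>' \<in> P2 \<Longrightarrow> \<xi>'' \<in> P3 \<Longrightarrow>
      \<kappa> * \<rho> * \<tau> / K \<le> \<bar>normal_cross \<xi> \<xi>' \<bullet> normal_vec \<xi>''\<bar>"
    and F: "tubes_over P1 F1" "tubes_over P2 F2" "tubes_over P3 F3"
    and R: "24 * B * K * R \<le> real M ^ n"
  shows "(\<integral>\<^sup>+x\<in>ball 0 R. ennreal (sqrt (\<Sum>T\<in>F1. indicator T x) * sqrt (\<Sum>T\<in>F2. indicator T x) *
      sqrt (\<Sum>T\<in>F3. indicator T x)) \<partial>lborel)
    \<le> ennreal (8 * ((8 * real c + 3) ^ 3) ^ n *
        (sqrt (625000000 * K * (3 + 192 * B * K)) * sqrt (1 / (\<kappa> * \<rho> * \<tau>))) *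
        (sqrt (card F1) * sqrt (card F2) * sqrt (card F3)))"
proof (cases "F1 = {} \<or> F2 = {} \<or> F3 = {}")
  case True
  then have "(\<lambda>x. ennreal (sqrt (\<Sum>T\<in>F1. indicator T x) * sqrt (\<Sum>T\<in>F2. indicator T x) *
      sqrt (\<Sum>T\<in>F3. indicator T x)) * indicator (ball 0 R) x) = (\<lambda>x. 0)" by (auto simp: fun_eq_iff)
  then show ?thesis by (simp add: zero_le)
next
  case False
  obtain \<xi>1 a1 where 1: "\<And>T. T \<in> F1 \<Longrightarrow> \<xi>1 T \<in> P1" "\<And>T. T \<in> F1 \<Longrightarrow> T = unit_tube (a1 T) (unit_normal (parab (\<xi>1 T)))"
    using tubes_over_choose[OF F(1)] by metis
  obtain \<xi>2 a2 where 2: "\<And>T. T \<in> F2 \<Longrightarrow> \<xi>2 T \<in> P2" "\<And>T. T \<in> F2 \<Longrightarrow> T = unit_tube (a2 T) (unit_normal (parab (\<xi>2 T)))"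
    using tubes_over_choose[OF F(2)] by metis
  obtain \<xi>3 a3 where 3: "\<And>T. T \<in> F3 \<Longrightarrow> \<xi>3 T \<in> P3" "\<And>T. T \<in> F3 \<Longrightarrow> T = unit_tube (a3 T) (unit_normal (parab (\<xi>3 T)))"
    using tubes_over_choose[OF F(3)] by metis
  obtain \<beta>1 \<beta>2 \<beta>3 where \<beta>: "\<beta>1 \<in> P1" "\<beta>2 \<in> P2" "\<beta>3 \<in> P3"
    using False 1(1) 2(1) 3(1) by blast
  define D where "D = normal_cross \<beta>1 \<beta>2 \<bullet> normal_vec \<beta>3"
  define \<Phi> where "\<Phi> = (\<lambda>x. vector [\<tau> * \<kappa> / D * (normal_cross \<beta>2 \<beta>3 \<bullet> x),
      \<tau> * \<kappa> / D * (normal_cross \<beta>3 \<beta>1 \<bullet> x), \<tau> * \<rho> / D * (normal_cross \<beta>1 \<beta>2 \<bullet> x)] :: real^3)"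
  have K0: "0 < K" and M1: "1 \<le> M" using pos M by auto
  note sc = steep_coordinates[OF w pos(1,2,4,5) K0 pos(7,8) _ _ _ _ _ _ D_def _ \<eta> M1 \<Phi>_def]
  have prem: "norm \<beta>1 \<le> 2" "norm \<beta>2 \<le> 2" "norm \<beta>3 \<le> 2"
    "in_box w (B * \<kappa>) (B * \<kappa> * \<tau>) (\<beta>1 - m)" "in_box w (B * \<kappa>) (B * \<kappa> * \<tau>) (\<beta>2 - m)"
    "in_box w (B * \<rho>) (B * \<rho> * \<tau>) (\<beta>3 - m)" "\<kappa> * \<rho> * \<tau> / K \<le> \<bar>D\<bar>"
    using \<beta> small box det unfolding D_def by auto
  have lin: "linear \<Phi>" by (rule sc(1)[OF prem])
  have bound: "\<bar>\<Phi> x $ k\<bar> \<le> 24 * B * K * norm x" for x k by (rule sc(2)[OF prem])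
  \<comment> \<open>Here \<open>125000 = 5000 * (24 + 1)\<close>: the summand 1 in the volume bound
    is absorbed by \<open>K / \<kappa> \<ge> 1\<close>. In \<open>b\<close>, likewise, 1 is absorbed
    by \<open>1 / (\<tau> * \<rho>)\<close>, which turns \<open>2 * (1 + 96 * B * K) + 1\<close>
    into \<open>3 + 192 * B * K\<close>.\<close>
  define a where "a = 125000 * K / \<kappa>"
  define b where "b = 5000 * (3 + 192 * B * K) / (\<tau> * \<rho>)"
  have ab: "0 < a" "0 < b" using pos K0 by (auto simp: a_def b_def add_pos_pos)
  have \<tau>\<rho>: "0 < \<tau> * \<rho>" "\<tau> * \<rho> \<le> 1" using pos by (auto intro: mult_le_one)
  have "(\<integral>\<^sup>+x\<in>ball 0 R. ennreal (sqrt (\<Sum>T\<in>F1. indicator T x) * sqrt (\<Sum>T\<in>F2. indicator T x) *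
      sqrt (\<Sum>T\<in>F3. indicator T x)) \<partial>lborel)
    \<le> ennreal (8 * ((8 * real c + 3) ^ 3) ^ n * sqrt (a * b) * (sqrt (card F1) * sqrt (card F2) * sqrt (card F3)))"
  proof (rule integral_of_steep_tubes_le[where ?p1.0 = a1 and ?p2.0 = a2 and ?p3.0 = a3 and M = M
      and ?u1.0 = "\<lambda>T. normal_vec (\<xi>1 T)" and ?u2.0 = "\<lambda>T. normal_vec (\<xi>2 T)" and ?u3.0 = "\<lambda>T. normal_vec (\<xi>3 T)",
      OF lin bound M c(1)])
    show "1 + 2 * (24 * B * K) \<le> real c" using c by simp
    show "finite F1" "finite F2" "finite F3" using F by (auto simp: tubes_over_def)
    show "T \<in> sets borel" if "T \<in> F1 \<union> F2 \<union> F3" for T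
      using that 1(2)[of T] 2(2)[of T] 3(2)[of T] unit_tube_borel by (metis Un_iff)
    show "\<exists>s. norm (x - (a1 T + s *\<^sub>R normal_vec (\<xi>1 T))) \<le> 2" if "T \<in> F1" "x \<in> T" for T x
      using unit_tube_near_axis 1(2)[OF that(1)] that(2) by blast
    show "\<exists>s. norm (x - (a2 T + s *\<^sub>R normal_vec (\<xi>2 T))) \<le> 2" if "T \<in> F2" "x \<in> T" for T x
      using unit_tube_near_axis 2(2)[OF that(1)] that(2) by blast
    show "\<exists>s. norm (x - (a3 T + s *\<^sub>R normal_vec (\<xi>3 T))) \<le> 2" if "T \<in> F3" "x \<in> T" for T x
      using unit_tube_near_axis 3(2)[OF that(1)] that(2) by blast
    show "\<forall>T\<in>F1. steep M 1 (\<Phi> (normal_vec (\<xi>1 T)))"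
      using sc(3)[OF prem] close(1)[OF 1(1) \<beta>(1)] by blast
    show "\<forall>T\<in>F2. steep M 2 (\<Phi> (normal_vec (\<xi>2 T)))"
      using sc(4)[OF prem] close(2)[OF 2(1) \<beta>(2)] by blast
    show "\<forall>T\<in>F3. steep M 3 (\<Phi> (normal_vec (\<xi>3 T)))"
      using sc(5)[OF prem] close(3)[OF 3(1) \<beta>(3)] by blast
    show "0 < a" "0 < b" by (rule ab)+
    show "emeasure lborel (S \<inter> T) \<le> ennreal a" if "S \<in> F1" "T \<in> F2" for S T
    proof -
      have "emeasure lborel (S \<inter> T) \<le> ennreal (5000 * (24 / (\<kappa> / K) + 1))"
        by (subst 1(2)[OF that(1)], subst 2(2)[OF that(2)], rule emeasure_tube_inter_le)
          (use 1(1)[OF that(1)] 2(1)[OF that(2)] small sep pos in auto)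
      also have "\<dots> \<le> ennreal a"
        using pos by (intro ennreal_leI) (simp add: a_def field_simps)
      finally show ?thesis .
    qed
    show "emeasure lborel {x \<in> T. \<lfloor>\<Phi> x $ 3\<rfloor> = z} \<le> ennreal b" if "T \<in> F3" for T z
    proof -
      have lin3: "linear (\<lambda>x. \<Phi> x $ 3)"
        using lin by (intro linearI) (simp_all add: linear_add linear_scale)
      have fast: "\<tau> * \<rho> / 2 \<le> \<bar>\<Phi> (normal_vec (\<xi>3 T)) $ 3\<bar>"
        using sc(6)[OF prem] close(3)[OF 3(1)[OF that] \<beta>(3)] by blast
      have "emeasure lborel {x \<in> T. \<lfloor>\<Phi> x $ 3\<rfloor> = z} \<le> ennreal (5000 * ((1 + 4 * (24 * B * K)) / (\<tau> * \<rho> / 2) + 1))"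
        by (subst 3(2)[OF that], rule emeasure_tube_slab_le[OF lin3 bound])
          (use 3(1)[OF that] small fast \<tau>\<rho> pos in auto)
      also have "\<dots> \<le> ennreal b"
      proof (rule ennreal_leI)
        define \<sigma> where "\<sigma> = \<tau> * \<rho>"
        have "1 \<le> 1 / \<sigma>" using \<tau>\<rho> by (simp add: \<sigma>_def)
        moreover have "b = 5000 * ((1 + 4 * (24 * B * K)) / (\<sigma> / 2) + 1 / \<sigma>)"
          unfolding b_def \<sigma>_def[symmetric] by (simp add: add_divide_distrib)
        ultimately show "5000 * ((1 + 4 * (24 * B * K)) / (\<tau> * \<rho> / 2) + 1) \<le> b"
          unfolding \<sigma>_def[symmetric] by (simp only: mult_left_mono add_left_mono zero_le_numeral)
      qed
      finally show ?thesis .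
    qed
    show "24 * B * K * R \<le> real M ^ n" by (rule R)
    show "0 < 24 * B * K" using pos by simp
  qed
  also have "a * b = (625000000 * K * (3 + 192 * B * K)) * (1 / (\<kappa> * \<rho> * \<tau>))"
    by (simp add: a_def b_def algebra_simps add_divide_distrib)
  finally show ?thesis by (simp only: real_sqrt_mult)
qed

section \<open>Splitting the families into boundedly many pieces\<close>

lemma sqrt_sum_le:
  assumes "finite A" "\<And>x. x \<in> A \<Longrightarrow> 0 \<le> f x"
  shows "sqrt (sum f A) \<le> (\<Sum>x\<in>A. sqrt (f x))"
  using assms
proof (induction A rule: finite_induct)
  case (insert x A)
  then have "sqrt (f x + sum f A) \<le> sqrt (f x) + sqrt (sum f A)"
    by (intro sqrt_add_le_add_sqrt sum_nonneg) auto
  also have "\<dots> \<le> sqrt (f x) + (\<Sum>x\<in>A. sqrt (f x))" using insert by simp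
  finally show ?case using insert by simp
qed simp

lemma sqrt_count_le_pieces:
  fixes F :: "'a set set"
  assumes "finite F" "finite J" "\<And>T. T \<in> F \<Longrightarrow> q T \<in> J"
  shows "sqrt (\<Sum>T\<in>F. indicator T x) \<le> (\<Sum>i\<in>J. sqrt (\<Sum>T\<in>{T\<in>F. q T = i}. indicator T x))"
proof -
  have "(\<Sum>T\<in>F. indicator T x) = (\<Sum>i\<in>J. \<Sum>T\<in>{T\<in>F. q T = i}. indicator T x :: real)"
    using assms by (intro sum.group[symmetric]) auto
  then show ?thesis using assms by (auto intro!: sqrt_sum_le sum_nonneg)
qed

text \<open>Subadditivity of the square root splits each factor over the labels in \<open>J\<close>,
  and the product expands into \<open>card J ^ 3\<close> triples.\<close>

lemma nn_integral_le_pieces: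
  fixes F1 F2 F3 :: "'a set set"
  assumes fin: "finite F1" "finite F2" "finite F3" "finite J"
    and q: "\<And>T. T \<in> F1 \<Longrightarrow> q1 T \<in> J" "\<And>T. T \<in> F2 \<Longrightarrow> q2 T \<in> J" "\<And>T. T \<in> F3 \<Longrightarrow> q3 T \<in> J"
    and meas: "\<And>T. T \<in> F1 \<union> F2 \<union> F3 \<Longrightarrow> T \<in> sets M" "Q \<in> sets M"
    and E: "0 \<le> E"
    and bound: "\<And>i j k. i \<in> J \<Longrightarrow> j \<in> J \<Longrightarrow> k \<in> J \<Longrightarrow>
      (\<integral>\<^sup>+x\<in>Q. ennreal (sqrt (\<Sum>T\<in>{T\<in>F1. q1 T = i}. indicator T x) * sqrt (\<Sum>T\<in>{T\<in>F2. q2 T = j}. indicator T x) *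
        sqrt (\<Sum>T\<in>{T\<in>F3. q3 T = k}. indicator T x)) \<partial>M) \<le> ennreal E"
  shows "(\<integral>\<^sup>+x\<in>Q. ennreal (sqrt (\<Sum>T\<in>F1. indicator T x) * sqrt (\<Sum>T\<in>F2. indicator T x) *
      sqrt (\<Sum>T\<in>F3. indicator T x)) \<partial>M) \<le> ennreal (real (card J) ^ 3 * E)"
proof -
  define f where "f i x = sqrt (\<Sum>T\<in>{T\<in>F1. q1 T = i}. indicator T x)" for i x
  define g where "g i x = sqrt (\<Sum>T\<in>{T\<in>F2. q2 T = i}. indicator T x)" for i x
  define h where "h i x = sqrt (\<Sum>T\<in>{T\<in>F3. q3 T = i}. indicator T x)" for i x
  have nonneg: "0 \<le> f i x" "0 \<le> g i x" "0 \<le> h i x" for i x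
    by (auto simp: f_def g_def h_def intro!: sum_nonneg)
  have m: "f i \<in> borel_measurable M" "g i \<in> borel_measurable M" "h i \<in> borel_measurable M" for i
    unfolding f_def g_def h_def using meas
    by (auto intro!: borel_measurable_sqrt borel_measurable_sum borel_measurable_indicator)
  have pw: "ennreal (sqrt (\<Sum>T\<in>F1. indicator T x) * sqrt (\<Sum>T\<in>F2. indicator T x) * sqrt (\<Sum>T\<in>F3. indicator T x)) * indicator Q x
    \<le> (\<Sum>i\<in>J. \<Sum>j\<in>J. \<Sum>k\<in>J. ennreal (f i x * g j x * h k x) * indicator Q x)" for x
  proof (cases "x \<in> Q")
    case True
    have "sqrt (\<Sum>T\<in>F1. indicator T x) * sqrt (\<Sum>T\<in>F2. indicator T x) * sqrt (\<Sum>T\<in>F3. indicator T x)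
      \<le> (\<Sum>i\<in>J. f i x) * (\<Sum>j\<in>J. g j x) * (\<Sum>k\<in>J. h k x)"
      unfolding f_def g_def h_def
      by (intro mult_mono sqrt_count_le_pieces fin q mult_nonneg_nonneg)
        (auto intro!: sum_nonneg mult_nonneg_nonneg)
    also have "\<dots> = (\<Sum>i\<in>J. \<Sum>j\<in>J. \<Sum>k\<in>J. f i x * g j x * h k x)"
      by (simp only: sum_distrib_left[symmetric] sum_distrib_right[symmetric])
    finally have "ennreal (sqrt (\<Sum>T\<in>F1. indicator T x) * sqrt (\<Sum>T\<in>F2. indicator T x) * sqrt (\<Sum>T\<in>F3. indicator T x))
      \<le> ennreal \<dots>" by (rule ennreal_leI)
    also have "\<dots> = (\<Sum>i\<in>J. \<Sum>j\<in>J. \<Sum>k\<in>J. ennreal (f i x * g j x * h k x))"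
      by (simp add: sum_nonneg nonneg)
    finally show ?thesis using True by simp
  qed simp
  have "(\<lambda>x. ennreal (f i x * g j x * h k x) * indicator Q x) \<in> borel_measurable M" for i j k
    using m meas(2) by simp
  then have "(\<integral>\<^sup>+x. (\<Sum>i\<in>J. \<Sum>j\<in>J. \<Sum>k\<in>J. ennreal (f i x * g j x * h k x) * indicator Q x) \<partial>M)
    = (\<Sum>i\<in>J. \<Sum>j\<in>J. \<Sum>k\<in>J. (\<integral>\<^sup>+x\<in>Q. ennreal (f i x * g j x * h k x) \<partial>M))"
    by (simp only: nn_integral_sum borel_measurable_sum)
  also have "\<dots> \<le> (\<Sum>i\<in>J. \<Sum>j\<in>J. \<Sum>k\<in>J. ennreal E)"
    unfolding f_def g_def h_def by (intro sum_mono bound)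
  also have "\<dots> = ennreal (real (card J) ^ 3 * E)"
    using E by (simp add: ennreal_of_nat_eq_real_of_nat ennreal_mult[symmetric] power3_eq_cube mult_ac)
  finally show ?thesis by (rule order.trans[rotated]) (intro nn_integral_mono pw)
qed

definition cell :: "real^2 \<Rightarrow> real \<Rightarrow> real \<Rightarrow> real^2 \<Rightarrow> int \<times> int" where
  "cell w a b x = (\<lfloor>(x \<bullet> w) / a\<rfloor>, \<lfloor>(x \<bullet> perp w) / b\<rfloor>)"

lemma cell_in:
  assumes "in_box w (B * a) (B * b) x" "B \<le> \<eta> * of_int N" "0 < a" "0 < b" "0 < \<eta>"
  shows "cell w (\<eta> * a) (\<eta> * b) x \<in> {- N..N} \<times> {- N..N}"
proof -
  have "\<lfloor>y / (\<eta> * s)\<rfloor> \<in> {- N..N}" if "\<bar>y\<bar> \<le> B * s" "0 < s" for y s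
  proof -
    have "B * s \<le> (\<eta> * of_int N) * s" using assms(2) that by (intro mult_right_mono) auto
    with that(1) have "\<bar>y\<bar> \<le> (\<eta> * of_int N) * s" by (rule order.trans)
    then have "\<bar>y\<bar> \<le> of_int N * (\<eta> * s)" by (simp add: mult_ac)
    then have "\<bar>y / (\<eta> * s)\<bar> \<le> of_int N" using that assms(5) by (simp add: field_simps)
    then show ?thesis unfolding atLeastAtMost_iff by linarith
  qed
  then show ?thesis using assms by (simp add: cell_def in_box_def)
qed

lemma cell_eq_imp_in_box:
  assumes "cell w a b x = cell w a b y" "0 < a" "0 < b"
  shows "in_box w a b (x - y)"
proof -
  have *: "\<bar>s - t\<bar> \<le> r" if "\<lfloor>s / r\<rfloor> = \<lfloor>t / r\<rfloor>" "0 < r" for s t r :: real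
  proof -
    have "\<bar>s / r - t / r\<bar> \<le> 1" using that(1) by linarith
    then have "\<bar>(s - t) / r\<bar> \<le> 1" by (simp add: diff_divide_distrib)
    then show ?thesis using that(2) by (simp add: field_simps)
  qed
  show ?thesis using assms * by (simp add: cell_def in_box_def inner_diff_left)
qed

text \<open>One parameter is fixed for each tube, so that labelling tubes by the label of the
  parameter is a genuine partition of the family.\<close>

lemma tubes_over_pieces:
  assumes "tubes_over A F"
  shows "\<exists>q. (\<forall>T\<in>F. q T \<in> f ` A) \<and> (\<forall>i. tubes_over {\<xi>\<in>A. f \<xi> = i} {T\<in>F. q T = i})"
proof -
  obtain \<xi> a where 1: "\<And>T. T \<in> F \<Longrightarrow> \<xi> T \<in> A" "\<And>T. T \<in> F \<Longrightarrow> T = unit_tube (a T) (unit_normal (parab (\<xi> T)))"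
    using tubes_over_choose[OF assms] by metis
  show ?thesis
  proof (intro exI[of _ "\<lambda>T. f (\<xi> T)"] conjI allI ballI)
    fix i
    have "\<exists>\<eta>\<in>{\<eta> \<in> A. f \<eta> = i}. \<exists>a. T = unit_tube a (unit_normal (parab \<eta>))" if "T \<in> F" "f (\<xi> T) = i" for T
      using 1[OF that(1)] that(2) by (intro bexI[of _ "\<xi> T"]) auto
    then show "tubes_over {\<xi> \<in> A. f \<xi> = i} {T \<in> F. f (\<xi> T) = i}"
      using assms by (simp add: tubes_over_def)
  qed (simp add: 1)
qed

text \<open>The least exponent that reaches \<open>X\<close> overshoots by at most a factor
  \<open>M\<close>. This upper bound is what later turns a constant to the power \<open>n\<close>
  into a power of \<open>R\<close>.\<close>

lemma exists_power_between:
  fixes X :: real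
  assumes "2 \<le> M" "1 \<le> X"
  shows "\<exists>n. X \<le> real M ^ n \<and> real M ^ n \<le> real M * X"
proof -
  have "\<exists>n. X \<le> real M ^ n"
    using real_arch_pow[of "real M" X] assms by (auto intro: less_imp_le)
  then obtain n where n: "X \<le> real M ^ n" and least: "\<And>l. l < n \<Longrightarrow> \<not> X \<le> real M ^ l"
    using exists_least_iff[of "\<lambda>n. X \<le> real M ^ n"] by blast
  have "real M ^ n \<le> real M * X"
  proof (cases n)
    case 0
    have "1 * 1 \<le> real M * X" using assms by (intro mult_mono) auto
    then show ?thesis using 0 by simp
  next
    case (Suc l)
    then have "real M ^ l \<le> X" using least[of l] by simp
    then show ?thesis unfolding Suc power_Suc by (intro mult_left_mono) auto
  qed
  then show ?thesis using n by blast
qed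

section \<open>Uniform bound for transversal boxes\<close>

text \<open>The type condition in planar terms. The quantity in the last clause is twice the area of
  the triangle with vertices \<open>\<xi>\<close>, \<open>\<xi>'\<close> and
  \<open>\<xi>''\<close>.\<close>

definition transversal_boxes where
  "transversal_boxes K B w m \<kappa> \<rho> \<tau> A1 A2 A3 \<longleftrightarrow>
    norm w = 1 \<and> 0 < \<kappa> \<and> \<kappa> \<le> \<rho> \<and> \<rho> \<le> 1 \<and> 0 < \<tau> \<and> \<tau> \<le> 1 \<and>
    (\<forall>\<xi>\<in>A1 \<union> A2 \<union> A3. norm \<xi> \<le> 2) \<and>
    (\<forall>\<xi>\<in>A1 \<union> A2. in_box w (B * \<kappa>) (B * \<kappa> * \<tau>) (\<xi> - m)) \<and>
    (\<forall>\<xi>\<in>A3. in_box w (B * \<rho>) (B * \<rho> * \<tau>) (\<xi> - m)) \<and>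
    (\<forall>\<xi>\<in>A1. \<forall>\<xi>'\<in>A2. \<kappa> / K \<le> norm (\<xi> - \<xi>')) \<and>
    (\<forall>\<xi>\<in>A1. \<forall>\<xi>'\<in>A2. \<forall>\<xi>''\<in>A3. \<kappa> * \<rho> * \<tau> / K \<le> \<bar>normal_cross \<xi> \<xi>' \<bullet> normal_vec \<xi>''\<bar>)"

text \<open>The order of choices makes the constant uniform: \<open>c\<close> and \<open>C0\<close>
  depend on \<open>B\<close> and \<open>K\<close>, then \<open>M\<close> on \<open>C0\<close> and
  \<epsilon>, then \<eta> on \<open>M\<close>, and the number of pieces on \<eta>. None depends on
  the boxes, the tubes or \<open>R\<close>.\<close>

lemma transversal_boxes_integral_bound:
  assumes K: "1 \<le> K" and B: "0 < B" and \<epsilon>: "0 < \<epsilon>"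
  shows "\<exists>C>0. \<forall>w m \<kappa> \<rho> \<tau> A1 A2 A3 F1 F2 F3. \<forall>R\<ge>1.
    transversal_boxes K B w m \<kappa> \<rho> \<tau> A1 A2 A3 \<longrightarrow>
    tubes_over A1 F1 \<longrightarrow> tubes_over A2 F2 \<longrightarrow> tubes_over A3 F3 \<longrightarrow>
    (\<integral>\<^sup>+x\<in>ball 0 R. ennreal (sqrt (\<Sum>T\<in>F1. indicator T x) * sqrt (\<Sum>T\<in>F2. indicator T x) *
      sqrt (\<Sum>T\<in>F3. indicator T x)) \<partial>lborel)
    \<le> ennreal (C * R powr \<epsilon> * sqrt (1 / (\<kappa> * \<rho> * \<tau>)) * (sqrt (card F1) * sqrt (card F2) * sqrt (card F3)))"
proof -
  define c where "c = nat \<lceil>2 + 48 * B * K\<rceil>"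
  have BK: "0 < B * K" using K B by simp
  have c: "2 \<le> c" "1 + 48 * B * K \<le> real c"
    unfolding c_def using BK by (simp_all add: le_nat_iff le_ceiling_iff) linarith+
  define C0 where "C0 = (8 * real c + 3) ^ 3"
  have C0: "1 \<le> C0" unfolding C0_def by (intro one_le_power) simp
  \<comment> \<open>\<open>M\<close> is so large that the cost \<open>C0\<close> of one scale is at
    most \<open>M powr \<epsilon>\<close>; then \<open>n\<close> scales cost at most
    \<open>(M ^ n) powr \<epsilon>\<close>.\<close>
  define M where "M = max 2 (nat \<lceil>C0 powr (1 / \<epsilon>)\<rceil>)"
  have M: "2 \<le> M" "C0 powr (1 / \<epsilon>) \<le> real M"
    using real_nat_ceiling_ge[of "C0 powr (1 / \<epsilon>)"] unfolding M_def by linarith+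
  have C0M: "C0 \<le> real M powr \<epsilon>"
  proof -
    have "C0 = (C0 powr (1 / \<epsilon>)) powr \<epsilon>" using C0 \<epsilon> by (simp add: powr_powr)
    also have "\<dots> \<le> real M powr \<epsilon>" using M \<epsilon> by (intro powr_mono2) auto
    finally show ?thesis .
  qed
  define \<eta> where "\<eta> = 1 / (4 * B * K * (real M + 1))"
  have \<eta>: "0 < \<eta>" "4 * B * K * \<eta> * (real M + 1) \<le> 1"
  proof -
    have "0 < 4 * (B * K) * (real M + 1)" using B K by (intro mult_pos_pos) auto
    then have X: "0 < 4 * B * K * (real M + 1)" by (simp only: mult.assoc)
    then show "0 < \<eta>" by (simp add: \<eta>_def)
    have "4 * B * K * \<eta> * (real M + 1) = 4 * B * K * (real M + 1) * \<eta>" by simp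
    also have "\<dots> = 1" using X B K by (simp add: \<eta>_def)
    finally show "4 * B * K * \<eta> * (real M + 1) \<le> 1" by simp
  qed
  define N where "N = \<lceil>B / \<eta>\<rceil>"
  have N: "B \<le> \<eta> * of_int N"
  proof -
    have "B / \<eta> \<le> of_int N" by (simp add: N_def)
    then show ?thesis using \<eta> by (simp add: field_simps)
  qed
  define J where "J = {- N..N} \<times> {- N..N}"
  define G where "G = sqrt (625000000 * K * (3 + 192 * B * K))"
  have G: "0 \<le> G" using BK K by (simp add: G_def)
  \<comment> \<open>The summand 1 ensures \<open>Y * R \<ge> 1\<close>, as the choice of the number
    of scales requires.\<close>
  define Y where "Y = 24 * B * K + 1"
  have Y: "1 \<le> Y" using BK by (simp add: Y_def)
  define C where "C = real (card J) ^ 3 * (8 * (real M * Y) powr \<epsilon> * G)"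
  have "0 \<le> C" using G by (simp add: C_def)
  show ?thesis
  proof (rule exI[of _ "C + 1"], intro conjI allI impI)
    show "0 < C + 1" using \<open>0 \<le> C\<close> by simp
    fix w m and \<kappa> \<rho> \<tau> :: real and A1 A2 A3 :: "(real^2) set" and F1 F2 F3 :: "(real^3) set set" and R :: real
    assume R: "1 \<le> R" and tb: "transversal_boxes K B w m \<kappa> \<rho> \<tau> A1 A2 A3"
      and F: "tubes_over A1 F1" "tubes_over A2 F2" "tubes_over A3 F3"
    from tb have w: "norm w = 1" and pos: "0 < \<kappa>" "\<kappa> \<le> \<rho>" "\<rho> \<le> 1" "0 < \<tau>" "\<tau> \<le> 1"
      and small: "\<And>\<xi>. \<xi> \<in> A1 \<union> A2 \<union> A3 \<Longrightarrow> norm \<xi> \<le> 2"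
      and box: "\<And>\<xi>. \<xi> \<in> A1 \<union> A2 \<Longrightarrow> in_box w (B * \<kappa>) (B * \<kappa> * \<tau>) (\<xi> - m)"
        "\<And>\<xi>. \<xi> \<in> A3 \<Longrightarrow> in_box w (B * \<rho>) (B * \<rho> * \<tau>) (\<xi> - m)"
      and sep: "\<And>\<xi> \<xi>'. \<xi> \<in> A1 \<Longrightarrow> \<xi>' \<in> A2 \<Longrightarrow> \<kappa> / K \<le> norm (\<xi> - \<xi>')"
      and det: "\<And>\<xi> \<xi>' \<xi>''. \<xi> \<in> A1 \<Longrightarrow> \<xi>' \<in> A2 \<Longrightarrow> \<xi>'' \<in> A3 \<Longrightarrow>
        \<kappa> * \<rho> * \<tau> / K \<le> \<bar>normal_cross \<xi> \<xi>' \<bullet> normal_vec \<xi>''\<bar>"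
      unfolding transversal_boxes_def by auto
    have \<rho>: "0 < \<rho>" using pos by simp
    \<comment> \<open>The grid has the proportions of the boxes, so the number of labels that occur
      is bounded independently of \<kappa>, \<rho> and \<tau>.\<close>
    define f where "f s \<xi> = cell w (\<eta> * s) (\<eta> * (s * \<tau>)) (\<xi> - m)" for s \<xi>
    obtain q1 where q1: "\<forall>T\<in>F1. q1 T \<in> f \<kappa> ` A1" "\<forall>i. tubes_over {\<xi>\<in>A1. f \<kappa> \<xi> = i} {T\<in>F1. q1 T = i}"
      using tubes_over_pieces[OF F(1), of "f \<kappa>"] by blast
    obtain q2 where q2: "\<forall>T\<in>F2. q2 T \<in> f \<kappa> ` A2" "\<forall>i. tubes_over {\<xi>\<in>A2. f \<kappa> \<xi> = i} {T\<in>F2. q2 T = i}"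
      using tubes_over_pieces[OF F(2), of "f \<kappa>"] by blast
    obtain q3 where q3: "\<forall>T\<in>F3. q3 T \<in> f \<rho> ` A3" "\<forall>i. tubes_over {\<xi>\<in>A3. f \<rho> \<xi> = i} {T\<in>F3. q3 T = i}"
      using tubes_over_pieces[OF F(3), of "f \<rho>"] by blast
    have fJ: "f s \<xi> \<in> J" if "in_box w (B * s) (B * s * \<tau>) (\<xi> - m)" "0 < s" for s \<xi>
      unfolding f_def J_def using that pos \<eta> N by (intro cell_in) (auto simp: mult.assoc)
    have f_close: "in_box w (\<eta> * s) (\<eta> * s * \<tau>) (\<xi> - \<xi>')" if "f s \<xi> = f s \<xi>'" "0 < s" for s \<xi> \<xi>'
      using cell_eq_imp_in_box[OF that(1)[unfolded f_def]] that(2) pos \<eta> by (simp add: mult.assoc)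
    obtain n where n: "Y * R \<le> real M ^ n" "real M ^ n \<le> real M * (Y * R)"
      using exists_power_between[OF M(1), of "Y * R"] mult_mono[of 1 Y 1 R] Y R by auto
    have MR: "24 * B * K * R \<le> real M ^ n"
      using n(1) R by (simp add: Y_def distrib_right)
    have C0n: "C0 ^ n \<le> (real M * Y) powr \<epsilon> * R powr \<epsilon>"
    proof -
      have "C0 ^ n \<le> (real M powr \<epsilon>) ^ n" using C0 C0M by (intro power_mono) auto
      also have "\<dots> = (real M ^ n) powr \<epsilon>"
      proof -
        have "0 < real M" using M by simp
        then have "(real M powr \<epsilon>) ^ n = (real M powr \<epsilon>) powr real n" by (intro powr_realpow[symmetric]) simp
        also have "\<dots> = (real M powr real n) powr \<epsilon>" by (simp only: powr_powr mult.commute)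
        also have "\<dots> = (real M ^ n) powr \<epsilon>" using \<open>0 < real M\<close> by (simp only: powr_realpow)
        finally show ?thesis .
      qed
      also have "\<dots> \<le> (real M * (Y * R)) powr \<epsilon>" using n \<epsilon> by (intro powr_mono2) auto
      also have "\<dots> = (real M * Y) powr \<epsilon> * R powr \<epsilon>"
        using powr_mult[of "real M * Y" R \<epsilon>] Y R by (simp only: mult.assoc)
      finally show ?thesis .
    qed
    define S where "S = sqrt (1 / (\<kappa> * \<rho> * \<tau>))"
    define P where "P = sqrt (card F1) * sqrt (card F2) * sqrt (card F3)"
    have SP: "0 \<le> S" "0 \<le> P" using pos \<rho> by (auto simp: S_def P_def)
    have finF: "finite F1" "finite F2" "finite F3" using F by (auto simp: tubes_over_def)
    have "(\<integral>\<^sup>+x\<in>ball 0 R. ennreal (sqrt (\<Sum>T\<in>F1. indicator T x) * sqrt (\<Sum>T\<in>F2. indicator T x) *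
      sqrt (\<Sum>T\<in>F3. indicator T x)) \<partial>lborel) \<le> ennreal (real (card J) ^ 3 * (8 * C0 ^ n * (G * S) * P))"
    proof (rule nn_integral_le_pieces[OF finF, of J q1 q2 q3])
      show "finite J" by (simp add: J_def)
      show "q1 T \<in> J" if "T \<in> F1" for T using bspec[OF q1(1) that] fJ box(1) pos by auto
      show "q2 T \<in> J" if "T \<in> F2" for T using bspec[OF q2(1) that] fJ box(1) pos by auto
      show "q3 T \<in> J" if "T \<in> F3" for T using bspec[OF q3(1) that] fJ box(2) \<rho> by auto
      show "T \<in> sets lborel" if "T \<in> F1 \<union> F2 \<union> F3" for T
        using that F unit_tube_borel unfolding tubes_over_def by auto
      show "ball 0 R \<in> sets lborel" by simp
      show "0 \<le> 8 * C0 ^ n * (G * S) * P" using C0 G SP by simp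
      fix i j k
      have "(\<integral>\<^sup>+x\<in>ball 0 R. ennreal (sqrt (\<Sum>T\<in>{T \<in> F1. q1 T = i}. indicator T x) *
          sqrt (\<Sum>T\<in>{T \<in> F2. q2 T = j}. indicator T x) * sqrt (\<Sum>T\<in>{T \<in> F3. q3 T = k}. indicator T x)) \<partial>lborel)
        \<le> ennreal (8 * ((8 * real c + 3) ^ 3) ^ n *
          (sqrt (625000000 * K * (3 + 192 * B * K)) * sqrt (1 / (\<kappa> * \<rho> * \<tau>))) *
          (sqrt (card {T \<in> F1. q1 T = i}) * sqrt (card {T \<in> F2. q2 T = j}) * sqrt (card {T \<in> F3. q3 T = k})))"
      proof (rule piece_bound[OF w pos K B \<eta>(1) \<eta>(2) M(1) c _ _ _ _ _ _ _ _ q1(2)[rule_format] q2(2)[rule_format] q3(2)[rule_format] MR, where m = m])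
        let ?P1 = "{\<xi> \<in> A1. f \<kappa> \<xi> = i}"
        let ?P2 = "{\<xi> \<in> A2. f \<kappa> \<xi> = j}"
        let ?P3 = "{\<xi> \<in> A3. f \<rho> \<xi> = k}"
        show "norm \<xi> \<le> 2" if "\<xi> \<in> ?P1 \<union> ?P2 \<union> ?P3" for \<xi>
          using that by (intro small) blast
        show "in_box w (B * \<kappa>) (B * \<kappa> * \<tau>) (\<xi> - m)" if "\<xi> \<in> ?P1 \<union> ?P2" for \<xi>
          using that by (intro box) blast
        show "in_box w (B * \<rho>) (B * \<rho> * \<tau>) (\<xi> - m)" if "\<xi> \<in> ?P3" for \<xi>
          using that by (intro box) blast
        show "in_box w (\<eta> * \<kappa>) (\<eta> * \<kappa> * \<tau>) (\<xi> - \<xi>')" if "\<xi> \<in> ?P1" "\<xi>' \<in> ?P1" for \<xi> \<xi>'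
          using that pos(1) by (intro f_close) simp_all
        show "in_box w (\<eta> * \<kappa>) (\<eta> * \<kappa> * \<tau>) (\<xi> - \<xi>')" if "\<xi> \<in> ?P2" "\<xi>' \<in> ?P2" for \<xi> \<xi>'
          using that pos(1) by (intro f_close) simp_all
        show "in_box w (\<eta> * \<rho>) (\<eta> * \<rho> * \<tau>) (\<xi> - \<xi>')" if "\<xi> \<in> ?P3" "\<xi>' \<in> ?P3" for \<xi> \<xi>'
          using that \<rho> by (intro f_close) simp_all
        show "\<kappa> / K \<le> norm (\<xi> - \<xi>')" if "\<xi> \<in> ?P1" "\<xi>' \<in> ?P2" for \<xi> \<xi>'
          using that by (intro sep) blast+
        show "\<kappa> * \<rho> * \<tau> / K \<le> \<bar>normal_cross \<xi> \<xi>' \<bullet> normal_vec \<xi>''\<bar>"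
          if "\<xi> \<in> ?P1" "\<xi>' \<in> ?P2" "\<xi>'' \<in> ?P3" for \<xi> \<xi>' \<xi>''
          using that by (intro det) blast+
      qed
      also have "\<dots> = ennreal (8 * C0 ^ n * (G * S) *
          (sqrt (card {T \<in> F1. q1 T = i}) * sqrt (card {T \<in> F2. q2 T = j}) * sqrt (card {T \<in> F3. q3 T = k})))"
        by (simp add: C0_def G_def S_def)
      also have "\<dots> \<le> ennreal (8 * C0 ^ n * (G * S) * P)"
        unfolding P_def using C0 G SP finF
        by (intro ennreal_leI mult_left_mono mult_mono real_sqrt_le_mono of_nat_mono card_mono mult_nonneg_nonneg) auto
      finally show "(\<integral>\<^sup>+x\<in>ball 0 R. ennreal (sqrt (\<Sum>T\<in>{T \<in> F1. q1 T = i}. indicator T x) *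
          sqrt (\<Sum>T\<in>{T \<in> F2. q2 T = j}. indicator T x) * sqrt (\<Sum>T\<in>{T \<in> F3. q3 T = k}. indicator T x)) \<partial>lborel)
        \<le> ennreal (8 * C0 ^ n * (G * S) * P)" .
    qed
    also have "\<dots> \<le> ennreal ((C + 1) * R powr \<epsilon> * S * P)"
    proof (rule ennreal_leI)
      have "real (card J) ^ 3 * (8 * C0 ^ n * (G * S) * P) = C0 ^ n * (real (card J) ^ 3 * (8 * (G * S) * P))"
        by simp
      also have "\<dots> \<le> ((real M * Y) powr \<epsilon> * R powr \<epsilon>) * (real (card J) ^ 3 * (8 * (G * S) * P))"
        using C0n G SP by (intro mult_right_mono) auto
      also have "\<dots> = C * (R powr \<epsilon> * S * P)" by (simp add: C_def)
      also have "\<dots> \<le> (C + 1) * (R powr \<epsilon> * S * P)" using SP by (intro mult_right_mono) auto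
      finally show "real (card J) ^ 3 * (8 * C0 ^ n * (G * S) * P) \<le> (C + 1) * R powr \<epsilon> * S * P"
        by (simp add: mult.assoc)
    qed
    finally show "(\<integral>\<^sup>+x\<in>ball 0 R. ennreal (sqrt (\<Sum>T\<in>F1. indicator T x) * sqrt (\<Sum>T\<in>F2. indicator T x) *
        sqrt (\<Sum>T\<in>F3. indicator T x)) \<partial>lborel)
      \<le> ennreal ((C + 1) * R powr \<epsilon> * sqrt (1 / (\<kappa> * \<rho> * \<tau>)) * (sqrt (card F1) * sqrt (card F2) * sqrt (card F3)))"
      by (simp only: S_def P_def)
  qed
qed

section \<open>Geometry of the type condition\<close>

lemma dyadic_square_diam:
  assumes "x \<in> dyadic_square i k" "y \<in> dyadic_square i k"
  shows "norm (x - y) \<le> 2 * (1/2)^i"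
proof -
  have "\<bar>(x - y) $ c\<bar> \<le> (1/2)^i" for c
    using assms by (auto simp: dyadic_square_def mem_box_cart abs_le_iff dest!: spec[of _ c])
  from this[of 1] this[of 2] show ?thesis using norm_vec2_le[of "x - y"] by linarith
qed

lemma dyadic_square_dist_le:
  assumes "x \<in> dyadic_square i k" "y \<in> dyadic_square i' k'"
    and "setdist (dyadic_square i k) (dyadic_square i' k') \<le> D"
  shows "norm (y - x) \<le> D + 2 * (1/2)^i + 2 * (1/2)^i'"
proof -
  have ne: "compact (dyadic_square i k)" "closed (dyadic_square i' k')"
    by (simp_all add: dyadic_square_def compact_cbox closed_cbox)
  obtain a b where a: "a \<in> dyadic_square i k" and b: "b \<in> dyadic_square i' k'"
      and d: "dist a b = setdist (dyadic_square i k) (dyadic_square i' k')"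
    using setdist_compact_closed[OF ne] assms(1,2) by blast
  have "y - x = (y - b) + ((b - a) + (a - x))" by simp
  also have "norm \<dots> \<le> norm (y - b) + (norm (b - a) + norm (a - x))"
    by (intro norm_triangle_mono order.refl norm_triangle_ineq)
  finally show ?thesis
    using dyadic_square_diam[OF assms(2) b] dyadic_square_diam[OF a assms(1)] d assms(3)
    by (simp add: dist_norm norm_minus_commute)
qed

lemma parab_inj: "parab x = parab y \<Longrightarrow> x = y"
  by (auto simp: parab_def vec_eq_iff forall_2 forall_3)

lemma inner_perp_self [simp]: "w \<bullet> perp w = 0"
  by (simp add: inner_vec2 perp_def)

text \<open>A strip in direction \<open>w'\<close> is read in the frame of \<open>w\<close>: the
  tilt moves a vector of length at most \<open>L\<close> sideways by at most
  \<open>L * (K * \<tau>)\<close>. This puts the third family into the frame of the first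
  two.\<close>

lemma in_box_of_strip:
  assumes w: "norm w = 1" "norm w' = 1" "norm (w - w') \<le> K * \<tau>"
    and x: "norm x \<le> L" "norm (x - (x \<bullet> w') *\<^sub>R w') \<le> \<sigma>" and nonneg: "0 \<le> L"
  shows "in_box w L (\<sigma> + L * (K * \<tau>)) x"
proof -
  let ?z = "x - (x \<bullet> w') *\<^sub>R w'"
  have "x \<bullet> perp w = ?z \<bullet> perp w + (x \<bullet> w') * ((w' - w) \<bullet> perp w)"
    by (simp add: inner_diff_left)
  also have "\<bar>\<dots>\<bar> \<le> \<bar>?z \<bullet> perp w\<bar> + \<bar>x \<bullet> w'\<bar> * \<bar>(w' - w) \<bullet> perp w\<bar>"
    unfolding abs_mult[symmetric] by (rule abs_triangle_ineq)
  also have "\<dots> \<le> \<sigma> + L * (K * \<tau>)"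
  proof (intro add_mono mult_mono)
    show "\<bar>?z \<bullet> perp w\<bar> \<le> \<sigma>" using Cauchy_Schwarz_ineq2[of ?z "perp w"] w x by simp
    show "\<bar>x \<bullet> w'\<bar> \<le> L" using Cauchy_Schwarz_ineq2[of x w'] w x by simp
    show "\<bar>(w' - w) \<bullet> perp w\<bar> \<le> K * \<tau>"
      using Cauchy_Schwarz_ineq2[of "w' - w" "perp w"] w by (simp add: norm_minus_commute)
  qed (use nonneg in auto)
  finally have "\<bar>x \<bullet> perp w\<bar> \<le> \<sigma> + L * (K * \<tau>)" .
  moreover have "\<bar>x \<bullet> w\<bar> \<le> L" using Cauchy_Schwarz_ineq2[of x w] w x by simp
  ultimately show ?thesis by (simp add: in_box_def)
qed

lemma norm_normal_vec_ge: "1 \<le> norm (normal_vec \<xi>)"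
  using component_le_norm_cart[of "normal_vec \<xi>" 3] by simp

text \<open>Each row is divided by a norm that is at least 1, so lower bounds on the wedge of unit
  normals pass to the unnormalised ones.\<close>

lemma det_unit_normal_le:
  "\<bar>det (\<chi> n::3. unit_normal (parab (\<xi> n)))\<bar> \<le> \<bar>det (\<chi> n. normal_vec (\<xi> n))\<bar>"
proof -
  have "det (\<chi> n::3. unit_normal (parab (\<xi> n))) = det (\<chi> n. inverse (norm (normal_vec (\<xi> n))) *s normal_vec (\<xi> n))"
    by (simp add: unit_normal_parab sgn_div_norm scalar_mult_eq_scaleR)
  also have "\<dots> = (\<Prod>n\<in>UNIV. inverse (norm (normal_vec (\<xi> n)))) * det (\<chi> n. normal_vec (\<xi> n))"
    by (rule det_rows_mul)
  finally have "\<bar>det (\<chi> n::3. unit_normal (parab (\<xi> n)))\<bar>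
      = (\<Prod>n\<in>UNIV. inverse (norm (normal_vec (\<xi> n)))) * \<bar>det (\<chi> n. normal_vec (\<xi> n))\<bar>"
    by (simp add: abs_mult prod_nonneg)
  also have "\<dots> \<le> 1 * \<bar>det (\<chi> n. normal_vec (\<xi> n))\<bar>"
    by (intro mult_right_mono prod_le_1) (auto simp: inverse_le_1_iff norm_normal_vec_ge)
  finally show ?thesis by simp
qed

lemma abs_det_permute_rows:
  fixes v :: "'n::finite \<Rightarrow> real^'n"
  assumes "bij p"
  shows "\<bar>det (\<chi> n. v (p n))\<bar> = \<bar>det (\<chi> n. v n)\<bar>"
proof -
  have "p permutes UNIV" using assms by (intro bij_imp_permutes) auto
  then have "det (\<chi> n. (\<chi> n. v n) $ p n) = of_int (sign p) * det (\<chi> n. v n)"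
    by (rule det_permute_rows)
  then show ?thesis by (simp add: abs_mult sign_def)
qed

text \<open>The constant \<open>K\<^sup>2\<close> arises from chaining two comparabilities, of the
  determinant with \<open>\<theta>\<close> and of \<open>\<theta>\<close> with
  \<open>\<kappa> * \<rho> * \<tau>\<close>.\<close>

lemma of_type_imp_transversal_boxes:
  assumes K: "1 \<le> K" and rj: "r \<le> j" and w: "norm w = 1" and fin: "\<And>n. finite (\<T> n)"
    and "of_type K r j t w m \<T>"
  shows "\<exists>(p :: 3 \<Rightarrow> 3) A1 A2 A3. bij p \<and>
    transversal_boxes (K\<^sup>2) ((K + 4) * (K + 1)) w m ((1/2)^j) ((1/2)^r) ((1/2)^t) A1 A2 A3 \<and>
    tubes_over A1 (\<T> (p 1)) \<and> tubes_over A2 (\<T> (p 2)) \<and> tubes_over A3 (\<T> (p 3))"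
proof -
  define \<kappa> where "\<kappa> = (1/2 :: real)^j"
  define \<rho> where "\<rho> = (1/2 :: real)^r"
  define \<tau> where "\<tau> = (1/2 :: real)^t"
  have pos: "0 < \<kappa>" "\<kappa> \<le> \<rho>" "0 < \<rho>" "\<rho> \<le> 1" "0 < \<tau>" "\<tau> \<le> 1"
    using rj by (auto simp: \<kappa>_def \<rho>_def \<tau>_def power_le_one intro: power_decreasing)
  \<comment> \<open>Points lie within \<open>K + 4\<close> side lengths of \<open>m\<close>, namely
    \<open>K\<close> for the distance of the squares and 4 for two diameters. The width in the
    tilted case is \<open>1 + (K + 4) * K\<close>; \<open>B\<close> dominates both.\<close>
  define B where "B = (K + 4) * (K + 1)"
  from assms(5)[unfolded of_type_def, folded \<kappa>_def \<rho>_def \<tau>_def] obtain S \<theta> k k' k'' w' and p :: "3 \<Rightarrow> 3" where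
    S2: "\<forall>n. S n \<subseteq> parab ` cball 0 2"
    and det: "\<forall>\<xi>. (\<forall>n. \<xi> n \<in> S n) \<longrightarrow> comparable K \<bar>det (\<chi> n. unit_normal (\<xi> n))\<bar> \<theta>"
    and T: "\<forall>n. \<forall>T\<in>\<T> n. \<exists>\<xi>\<in>S n. \<exists>a. T = unit_tube a (unit_normal \<xi>)"
    and p: "bij p" and w': "w' \<in> sphere 0 1"
    and S: "S (p 1) \<subseteq> parab ` (dyadic_square j k \<inter> strip (j + t) w m)"
        "S (p 2) \<subseteq> parab ` (dyadic_square j k' \<inter> strip (j + t) w m)"
        "S (p 3) \<subseteq> parab ` (dyadic_square r k'' \<inter> strip (r + t) w' m)"
    and m: "m \<in> dyadic_square j k"
    and d12: "comparable K (setdist (dyadic_square j k) (dyadic_square j k')) \<kappa>"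
    and d13: "comparable K (setdist (dyadic_square j k) (dyadic_square r k'')) \<rho>"
    and ww': "comparable K (norm (w - w')) \<tau>"
    and \<theta>: "comparable K \<theta> (\<kappa> * \<rho> * \<tau>)"
    by (elim exE conjE) (rule that, assumption+)
  define A where "A n = {\<xi>. norm \<xi> \<le> 2 \<and> parab \<xi> \<in> S n}" for n
  have A_iff: "\<xi> \<in> X" if "\<xi> \<in> A n" "S n \<subseteq> parab ` X" for \<xi> n X
    using that parab_inj by (force simp: A_def)
  have over: "tubes_over (A n) (\<T> n)" for n
    unfolding tubes_over_def
  proof (intro conjI fin ballI)
    fix T assume "T \<in> \<T> n"
    then obtain q a where q: "q \<in> S n" "T = unit_tube a (unit_normal q)" using T by blast
    then obtain \<xi> where "q = parab \<xi>" "norm \<xi> \<le> 2" using S2 by fastforce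
    then show "\<exists>\<xi>\<in>A n. \<exists>a. T = unit_tube a (unit_normal (parab \<xi>))"
      using q by (auto simp: A_def)
  qed
  have KB: "K + 4 \<le> B" "1 + (K + 4) * K \<le> B" using K by (simp_all add: B_def algebra_simps)
  have box12: "in_box w (B * \<kappa>) (B * \<kappa> * \<tau>) x"
    if "norm x \<le> (K + 4) * \<kappa>" "norm (x - (x \<bullet> w) *\<^sub>R w) \<le> \<kappa> * \<tau>" for x
  proof (rule in_box_mono)
    \<comment> \<open>The first two strips already have direction \<open>w\<close>, so the tilt
      constant is 0.\<close>
    show "in_box w ((K + 4) * \<kappa>) (\<kappa> * \<tau> + (K + 4) * \<kappa> * (0 * \<tau>)) x"
      using w that K pos by (intro in_box_of_strip[of w w]) auto
    show "(K + 4) * \<kappa> \<le> B * \<kappa>" using KB pos by (intro mult_right_mono) auto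
    have "1 * (\<kappa> * \<tau>) \<le> B * (\<kappa> * \<tau>)" using KB K pos by (intro mult_right_mono) auto
    then show "\<kappa> * \<tau> + (K + 4) * \<kappa> * (0 * \<tau>) \<le> B * \<kappa> * \<tau>" by simp
  qed
  have box1: "in_box w (B * \<kappa>) (B * \<kappa> * \<tau>) (\<xi> - m)" if "\<xi> \<in> A (p 1)" for \<xi>
  proof (rule box12)
    have \<xi>: "\<xi> \<in> dyadic_square j k \<inter> strip (j + t) w m" by (rule A_iff[OF that S(1)])
    then have "norm (\<xi> - m) \<le> 2 * \<kappa>" using dyadic_square_diam[OF _ m] by (auto simp: \<kappa>_def)
    also have "\<dots> \<le> (K + 4) * \<kappa>" using K pos by (intro mult_right_mono) auto
    finally show "norm (\<xi> - m) \<le> (K + 4) * \<kappa>" .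
    show "norm (\<xi> - m - ((\<xi> - m) \<bullet> w) *\<^sub>R w) \<le> \<kappa> * \<tau>"
      using \<xi> by (simp add: strip_def \<kappa>_def \<tau>_def power_add)
  qed
  have box2: "in_box w (B * \<kappa>) (B * \<kappa> * \<tau>) (\<xi> - m)" if "\<xi> \<in> A (p 2)" for \<xi>
  proof (rule box12)
    have \<xi>: "\<xi> \<in> dyadic_square j k' \<inter> strip (j + t) w m" by (rule A_iff[OF that S(2)])
    then have "norm (\<xi> - m) \<le> K * \<kappa> + 2 * \<kappa> + 2 * \<kappa>"
      using dyadic_square_dist_le[OF m, of \<xi> j k' "K * \<kappa>"] d12 by (auto simp: \<kappa>_def comparable_def)
    then show "norm (\<xi> - m) \<le> (K + 4) * \<kappa>" by (simp add: algebra_simps)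
    show "norm (\<xi> - m - ((\<xi> - m) \<bullet> w) *\<^sub>R w) \<le> \<kappa> * \<tau>"
      using \<xi> by (simp add: strip_def \<kappa>_def \<tau>_def power_add)
  qed
  have box3: "in_box w (B * \<rho>) (B * \<rho> * \<tau>) (\<xi> - m)" if "\<xi> \<in> A (p 3)" for \<xi>
  proof (rule in_box_mono)
    have \<xi>: "\<xi> \<in> dyadic_square r k'' \<inter> strip (r + t) w' m" by (rule A_iff[OF that S(3)])
    then have "norm (\<xi> - m) \<le> K * \<rho> + 2 * \<kappa> + 2 * \<rho>"
      using dyadic_square_dist_le[OF m, of \<xi> r k'' "K * \<rho>"] d13 by (auto simp: \<kappa>_def \<rho>_def comparable_def)
    then have "norm (\<xi> - m) \<le> (K + 4) * \<rho>" using pos by (simp add: algebra_simps)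
    moreover have "norm (\<xi> - m - ((\<xi> - m) \<bullet> w') *\<^sub>R w') \<le> \<rho> * \<tau>"
      using \<xi> by (simp add: strip_def \<rho>_def \<tau>_def power_add)
    ultimately show "in_box w ((K + 4) * \<rho>) (\<rho> * \<tau> + (K + 4) * \<rho> * (K * \<tau>)) (\<xi> - m)"
      using w w' ww' K pos by (intro in_box_of_strip[of w w']) (auto simp: comparable_def)
    show "(K + 4) * \<rho> \<le> B * \<rho>" using KB pos by (intro mult_right_mono) auto
    have "(1 + (K + 4) * K) * (\<rho> * \<tau>) \<le> B * (\<rho> * \<tau>)" using KB pos by (intro mult_right_mono) auto
    then show "\<rho> * \<tau> + (K + 4) * \<rho> * (K * \<tau>) \<le> B * \<rho> * \<tau>" by (simp add: algebra_simps)
  qed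
  have sep: "\<kappa> / K\<^sup>2 \<le> norm (\<xi> - \<xi>')" if "\<xi> \<in> A (p 1)" "\<xi>' \<in> A (p 2)" for \<xi> \<xi>'
  proof -
    have "\<xi> \<in> dyadic_square j k" "\<xi>' \<in> dyadic_square j k'"
      using A_iff[OF that(1) S(1)] A_iff[OF that(2) S(2)] by auto
    then have "setdist (dyadic_square j k) (dyadic_square j k') \<le> norm (\<xi> - \<xi>')"
      unfolding dist_norm[symmetric] by (rule setdist_le_dist)
    moreover have "\<kappa> / K\<^sup>2 \<le> \<kappa> / K"
      using K pos by (intro divide_left_mono) (auto simp: power2_eq_square)
    ultimately show ?thesis using d12 unfolding comparable_def by linarith
  qed
  have wedge: "\<kappa> * \<rho> * \<tau> / K\<^sup>2 \<le> \<bar>normal_cross \<xi>1 \<xi>2 \<bullet> normal_vec \<xi>3\<bar>"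
    if A: "\<xi>1 \<in> A (p 1)" "\<xi>2 \<in> A (p 2)" "\<xi>3 \<in> A (p 3)" for \<xi>1 \<xi>2 \<xi>3
  proof -
    \<comment> \<open>The determinant hypothesis is indexed in the original order of the families.
      The points are put there through \<open>inv p\<close>, and undoing the permutation changes
      only the sign.\<close>
    define v :: "3 \<Rightarrow> real^2" where "v n = (if n = 1 then \<xi>1 else if n = 2 then \<xi>2 else \<xi>3)" for n
    have v: "v 1 = \<xi>1" "v 2 = \<xi>2" "v 3 = \<xi>3" by (simp_all add: v_def)
    have vA: "v i \<in> A (p i)" for i using A v exhaust_3[of i] by auto
    have inv: "inv p (p i) = i" "p (inv p i) = i" for i
      using p by (simp_all add: bij_is_inj bij_is_surj surj_f_inv_f)
    have "parab (v (inv p n)) \<in> S n" for n using vA[of "inv p n"] by (simp add: A_def inv)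
    then have "comparable K \<bar>det (\<chi> n. unit_normal (parab (v (inv p n))))\<bar> \<theta>"
      using det[rule_format, of "\<lambda>n. parab (v (inv p n))"] by simp
    then have "\<theta> / K \<le> \<bar>det (\<chi> n. unit_normal (parab (v (inv p n))))\<bar>" by (simp add: comparable_def)
    also have "\<dots> \<le> \<bar>det (\<chi> n. normal_vec (v (inv p n)))\<bar>" by (rule det_unit_normal_le)
    also have "\<dots> = \<bar>det (\<chi> n. normal_vec (v n))\<bar>"
      using abs_det_permute_rows[OF bij_imp_bij_inv[OF p], of "\<lambda>n. normal_vec (v n)"] .
    also have "\<dots> = \<bar>normal_cross \<xi>1 \<xi>2 \<bullet> normal_vec \<xi>3\<bar>"
      using normal_cross_det[of v] by (simp add: v)
    finally have "\<theta> / K \<le> \<bar>normal_cross \<xi>1 \<xi>2 \<bullet> normal_vec \<xi>3\<bar>" .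
    moreover have "\<kappa> * \<rho> * \<tau> / K\<^sup>2 \<le> \<theta> / K"
    proof -
      have "(\<kappa> * \<rho> * \<tau> / K) / K \<le> \<theta> / K" using \<theta> K unfolding comparable_def by (intro divide_right_mono) auto
      then show ?thesis by (simp add: power2_eq_square)
    qed
    ultimately show ?thesis by linarith
  qed
  have "transversal_boxes (K\<^sup>2) B w m \<kappa> \<rho> \<tau> (A (p 1)) (A (p 2)) (A (p 3))"
    unfolding transversal_boxes_def
    using w pos box1 box2 box3 sep wedge by (auto simp: A_def)
  then show ?thesis
    using p over unfolding B_def \<kappa>_def \<rho>_def \<tau>_def by blast
qed

section \<open>Small balls and conclusion\<close>

text \<open>For \<open>R \<le> 1\<close> the trivial estimate suffices: the integrand is at most the
  product of the roots of the cardinalities, and the volume \<open>8 * R ^ 3\<close> is at most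
  \<open>8 * R powr \<epsilon>\<close> since \<open>\<epsilon> \<le> 3\<close>.\<close>

lemma nn_integral_small_ball_le:
  fixes F1 F2 F3 :: "(real^3) set set"
  assumes R: "0 < R" "R \<le> 1" and \<epsilon>: "\<epsilon> \<le> 3" and fin: "finite F1" "finite F2" "finite F3"
  shows "(\<integral>\<^sup>+x\<in>ball 0 R. ennreal (sqrt (\<Sum>T\<in>F1. indicator T x) * sqrt (\<Sum>T\<in>F2. indicator T x) *
      sqrt (\<Sum>T\<in>F3. indicator T x)) \<partial>lborel)
    \<le> ennreal (8 * R powr \<epsilon> * (sqrt (card F1) * sqrt (card F2) * sqrt (card F3)))"
proof -
  let ?P = "sqrt (card F1) * sqrt (card F2) * sqrt (card F3)"
  have count: "(\<Sum>T\<in>F. indicator T x) \<le> real (card F)" if "finite F" for F :: "(real^3) set set" and x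
  proof -
    have "(\<Sum>T\<in>F. indicator T x) \<le> (\<Sum>T\<in>F. 1 :: real)" by (intro sum_mono) (simp add: indicator_def)
    then show ?thesis by simp
  qed
  have "(\<integral>\<^sup>+x\<in>ball 0 R. ennreal (sqrt (\<Sum>T\<in>F1. indicator T x) * sqrt (\<Sum>T\<in>F2. indicator T x) *
      sqrt (\<Sum>T\<in>F3. indicator T x)) \<partial>lborel) \<le> (\<integral>\<^sup>+x. ennreal ?P * indicator (ball 0 R :: (real^3) set) x \<partial>lborel)"
  proof (rule nn_integral_mono)
    fix x :: "real^3"
    have "sqrt (\<Sum>T\<in>F1. indicator T x) * sqrt (\<Sum>T\<in>F2. indicator T x) * sqrt (\<Sum>T\<in>F3. indicator T x) \<le> ?P"
      by (intro mult_mono real_sqrt_le_mono count fin mult_nonneg_nonneg) (auto intro!: sum_nonneg)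
    then show "ennreal (sqrt (\<Sum>T\<in>F1. indicator T x) * sqrt (\<Sum>T\<in>F2. indicator T x) *
      sqrt (\<Sum>T\<in>F3. indicator T x)) * indicator (ball 0 R) x \<le> ennreal ?P * indicator (ball 0 R) x"
      by (intro mult_right_mono ennreal_leI) auto
  qed
  also have "\<dots> = ennreal ?P * emeasure lborel (ball (0 :: real^3) R)"
    by (simp add: nn_integral_cmult_indicator)
  also have "\<dots> \<le> ennreal ?P * ennreal (8 * R ^ 3)"
    using R by (intro mult_left_mono order.trans[OF emeasure_mono emeasure_lborel_cball_le[of _ 0]]) auto
  also have "\<dots> = ennreal (8 * R ^ 3 * ?P)"
    using R by (subst ennreal_mult[symmetric]) (auto simp: mult_ac)
  also have "\<dots> \<le> ennreal (8 * R powr \<epsilon> * ?P)"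
  proof (intro ennreal_leI mult_right_mono mult_left_mono)
    have "R ^ 3 = R powr 3" using R by (simp add: powr_numeral)
    also have "\<dots> \<le> R powr \<epsilon>" using R \<epsilon> by (intro powr_mono') auto
    finally show "R ^ 3 \<le> R powr \<epsilon>" .
  qed auto
  finally show ?thesis .
qed

lemma prod_UNIV_3_permute:
  fixes p :: "3 \<Rightarrow> 3"
  assumes "bij p"
  shows "(\<Prod>n\<in>UNIV. g n) = (g (p 1) * g (p 2) * g (p 3) :: 'a::comm_monoid_mult)"
proof -
  have "(\<Prod>n\<in>UNIV. g n) = (\<Prod>n\<in>UNIV. g (p n))"
    using prod.reindex_bij_betw[OF assms, of g] by simp
  also have "\<dots> = g (p 1) * g (p 2) * g (p 3)"
    unfolding UNIV_3 by (simp add: mult.assoc)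
  finally show ?thesis .
qed

text \<open>On small balls the exponent is restricted because a ball inside all tubes gives an
  integral of order \<open>R ^ 3\<close>, which a multiple of \<open>R powr \<epsilon>\<close>
  dominates as \<open>R\<close> tends to 0 only for \<open>\<epsilon> \<le> 3\<close>.\<close>

theorem theorem2:
  fixes K \<epsilon> :: real
  assumes "K \<ge> 1" and "\<epsilon> > 0"
  shows "\<exists>C::real. \<forall>(r::nat) (j::nat) (t::nat) (w::real^2) (m::real^2)
      (\<T> :: 3 \<Rightarrow> (real^3) set set) (R::real).
    r \<le> j \<longrightarrow> w \<in> sphere 0 1 \<longrightarrow> (\<forall>n. finite (\<T> n)) \<longrightarrow> of_type K r j t w m \<T> \<longrightarrow>
    R > 0 \<longrightarrow> (R \<ge> 1 \<or> \<epsilon> \<le> 3) \<longrightarrow>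
    (LINT x:ball 0 R|lborel. (\<Prod>n\<in>UNIV. (\<Sum>T\<in>\<T> n. indicator T x) powr (1/2)))
      \<le> C * R powr \<epsilon> * 2 powr (1/2 * real (j + t + r)) * (\<Prod>n\<in>UNIV. real (card (\<T> n)) powr (1/2))"
proof -
  let ?B = "(K + 4) * (K + 1)"
  have "1 \<le> K\<^sup>2" "0 < ?B" using assms by auto
  from transversal_boxes_integral_bound[OF this assms(2)]
  obtain C where C: "0 < C" and bound: "\<forall>w m \<kappa> \<rho> \<tau> A1 A2 A3 F1 F2 F3. \<forall>R\<ge>1.
      transversal_boxes (K\<^sup>2) ?B w m \<kappa> \<rho> \<tau> A1 A2 A3 \<longrightarrow>
      tubes_over A1 F1 \<longrightarrow> tubes_over A2 F2 \<longrightarrow> tubes_over A3 F3 \<longrightarrow>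
      (\<integral>\<^sup>+x\<in>ball 0 R. ennreal (sqrt (\<Sum>T\<in>F1. indicator T x) * sqrt (\<Sum>T\<in>F2. indicator T x) *
        sqrt (\<Sum>T\<in>F3. indicator T x)) \<partial>lborel)
      \<le> ennreal (C * R powr \<epsilon> * sqrt (1 / (\<kappa> * \<rho> * \<tau>)) * (sqrt (card F1) * sqrt (card F2) * sqrt (card F3)))"
    by (elim exE conjE) (rule that)
  show ?thesis
  \<comment> \<open>\<open>C\<close> serves the balls with \<open>R \<ge> 1\<close> and 8 the
    smaller ones, where the factor \<open>E \<ge> 1\<close> is inserted for free.\<close>
  proof (rule exI[of _ "C + 8"], intro allI impI)
    fix r j t :: nat and w m :: "real^2" and \<T> :: "3 \<Rightarrow> (real^3) set set" and R :: real
    assume rj: "r \<le> j" and w: "w \<in> sphere 0 1" and fin: "\<forall>n. finite (\<T> n)"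
      and type: "of_type K r j t w m \<T>" and R: "0 < R" "1 \<le> R \<or> \<epsilon> \<le> 3"
    have "norm w = 1" using w by simp
    from of_type_imp_transversal_boxes[OF assms(1) rj this fin[rule_format] type]
    obtain p :: "3 \<Rightarrow> 3" and A1 A2 A3 where p: "bij p"
      and tb: "transversal_boxes (K\<^sup>2) ?B w m ((1/2)^j) ((1/2)^r) ((1/2)^t) A1 A2 A3"
      and over: "tubes_over A1 (\<T> (p 1))" "tubes_over A2 (\<T> (p 2))" "tubes_over A3 (\<T> (p 3))"
      by blast
    define P where "P = sqrt (card (\<T> (p 1))) * sqrt (card (\<T> (p 2))) * sqrt (card (\<T> (p 3)))"
    define E where "E = 2 powr (1/2 * real (j + t + r))"
    have P: "0 \<le> P" by (simp add: P_def)
    have E1: "1 \<le> E" unfolding E_def by (intro ge_one_powr_ge_zero) auto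
    have E: "sqrt (1 / ((1/2)^j * (1/2)^r * (1/2)^t)) = E"
    proof -
      have "1 / ((1/2)^j * (1/2)^r * (1/2)^t) = (2::real) ^ (j + t + r)"
        by (simp add: power_add power_one_over)
      also have "\<dots> = 2 powr real (j + t + r)" by (rule powr_realpow[symmetric]) simp
      finally have "sqrt (1 / ((1/2)^j * (1/2)^r * (1/2)^t)) = sqrt (2 powr real (j + t + r))"
        by (rule arg_cong)
      also have "\<dots> = (2 powr real (j + t + r)) powr (1/2)" by (rule powr_half_sqrt[symmetric]) simp
      also have "\<dots> = E" unfolding E_def powr_powr by (simp only: mult.commute)
      finally show ?thesis .
    qed
    let ?g = "\<lambda>x. sqrt (\<Sum>T\<in>\<T> (p 1). indicator T x) * sqrt (\<Sum>T\<in>\<T> (p 2). indicator T x) *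
        sqrt (\<Sum>T\<in>\<T> (p 3). indicator T x)"
    have g: "(\<Prod>n\<in>UNIV. (\<Sum>T\<in>\<T> n. indicator T x) powr (1/2)) = ?g x" for x
      by (simp add: prod_UNIV_3_permute[OF p] powr_half_sqrt sum_nonneg)
    have P_eq: "(\<Prod>n\<in>UNIV. real (card (\<T> n)) powr (1/2)) = P"
      by (simp add: prod_UNIV_3_permute[OF p] powr_half_sqrt P_def)
    have "(\<integral>\<^sup>+x\<in>ball 0 R. ennreal (?g x) \<partial>lborel) \<le> ennreal ((C + 8) * R powr \<epsilon> * E * P)"
    proof (cases "1 \<le> R")
      case True
      have "(\<integral>\<^sup>+x\<in>ball 0 R. ennreal (?g x) \<partial>lborel) \<le> ennreal (C * R powr \<epsilon> * E * P)"
        using bound[rule_format, OF True tb over] unfolding E P_def .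
      also have "\<dots> \<le> ennreal ((C + 8) * R powr \<epsilon> * E * P)"
        using P E1 by (intro ennreal_leI mult_right_mono) auto
      finally show ?thesis .
    next
      case False
      have "(\<integral>\<^sup>+x\<in>ball 0 R. ennreal (?g x) \<partial>lborel) \<le> ennreal (8 * R powr \<epsilon> * P)"
        unfolding P_def using False R fin by (intro nn_integral_small_ball_le) auto
      also have "\<dots> \<le> ennreal ((C + 8) * R powr \<epsilon> * E * P)"
      proof (intro ennreal_leI mult_right_mono P)
        have "8 * R powr \<epsilon> * 1 \<le> (C + 8) * R powr \<epsilon> * E"
          using C E1 by (intro mult_mono mult_nonneg_nonneg) auto
        then show "8 * R powr \<epsilon> \<le> (C + 8) * R powr \<epsilon> * E" by simp
      qed
      finally show ?thesis .
    qed
    moreover have "ennreal (indicator (ball 0 R) x *\<^sub>R ?g x) = ennreal (?g x) * indicator (ball 0 R) x" for x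
      by (simp add: indicator_def)
    ultimately have "integral\<^sup>L lborel (\<lambda>x. indicator (ball 0 R) x *\<^sub>R ?g x) \<le> (C + 8) * R powr \<epsilon> * E * P"
      using P E1 C by (intro integral_real_bounded) simp_all
    then show "(LINT x:ball 0 R|lborel. (\<Prod>n\<in>UNIV. (\<Sum>T\<in>\<T> n. indicator T x) powr (1/2)))
      \<le> (C + 8) * R powr \<epsilon> * 2 powr (1/2 * real (j + t + r)) * (\<Prod>n\<in>UNIV. real (card (\<T> n)) powr (1/2))"
      unfolding set_lebesgue_integral_def g P_eq E_def .
  qed
qed

end
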